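(* Let $\lambda=(n_1^{m_1},n_2^{m_2},\ldots,n_L^{m_L})$ be a refined partition of $n$ and let $\mathcal{B}_\lambda\subseteq\mathcal{M}_n$ be the corresponding subalgebra. Set $r=\sum_{i=1}^L m_i$ and $\ell=\mathrm{lcm}\{m_1,m_2,\ldots,m_L\}$. If $X\in\mathcal{M}_n$ is positive, then \[ \|P_{\mathcal{B}_\lambda}(X)\|_{\mathrm{op}}\ge\frac{1}{r\ell}\|X\|_{\mathrm{op}}. \] Moreover, \[ \|X\|_{\mathcal{B}_\lambda}\ge\frac{1}{\sqrt{r\ell}}\|X\|_{\mathrm{op}} \] for all $X\in\mathcal{M}_n$.
   Context: $\mathcal{M}_n$ is the C*-algebra of complex $n\times n$ matrices with operator norm $\|\cdot\|_{\mathrm{op}}$ induced by the 2-norm on $\mathbb{C}^n$; positive means positive semidefinite. A refined partition of $n$ is a formal expression $\lambda=(n_1^{m_1},\ldots,n_L^{m_L})$ with $L,n_i,m_i\in\{1,2,\ldots\}$ and $n=\sum_{i=1}^L m_in_i$ (the $n_i$ need not be distinct). The corresponding subalgebra is $\mathcal{B}_\lambda=\bigoplus_{i=1}^L(I_{m_i}\otimes\mathcal{M}_{n_i})\subseteq\mathcal{M}_n$, i.e. the block-diagonal matrices $\mathrm{diag}(A_1,\ldots,A_1,\ldots,A_L,\ldots,A_L)$ with $A_i\in\mathcal{M}_{n_i}$ repeated $m_i$ times. For a unital C*-subalgebra $\mathcal{B}\subseteq\mathcal{M}_n$ (containing $I_n$), $P_{\mathcal{B}}:\mathcal{M}_n\to\mathcal{B}$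 is the unique conditional expectation onto $\mathcal{B}$ (linear map with $P(B)=B$ for $B\in\mathcal{B}$ and $\|P(A)\|_{\mathrm{op}}\le\|A\|_{\mathrm{op}}$) that preserves $\tau=\frac1n\mathrm{Tr}$, i.e. $\tau\circ P_{\mathcal{B}}=\tau$; equivalently, $P_{\mathcal{B}}$ is the orthogonal projection onto $\mathcal{B}$ for the inner product $\langle A,B\rangle=\tau(B^*A)$. The Frobenius--Rieffel norm is $\|A\|_{\mathcal{B}}=\sqrt{\|P_{\mathcal{B}}(A^*A)\|_{\mathrm{op}}}$. *)

theory Defs
  imports
    "HOL-Analysis.L2_Norm"
    "HOL-Library.FuncSet"
    "Jordan_Normal_Form.Matrix"
    "Jordan_Normal_Form.Schur_Decomposition"
begin

definition vec_norm2 :: "complex vec \<Rightarrow> real" where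
  "vec_norm2 v = L2_set (\<lambda>i. cmod (v $ i)) {..<dim_vec v}"

definition op_norm :: "complex mat \<Rightarrow> real" where
  "op_norm A = Sup {vec_norm2 (A *\<^sub>v v) | v. v \<in> carrier_vec (dim_col A) \<and> vec_norm2 v \<le> 1}"

definition psd :: "complex mat \<Rightarrow> bool" where
  "psd A \<longleftrightarrow> square_mat A \<and> mat_adjoint A = A \<and>
     (\<forall>v \<in> carrier_vec (dim_row A). 0 \<le> Re ((A *\<^sub>v v) \<bullet>c v))"

text \<open>The normalised trace.\<close>

definition tau :: "complex mat \<Rightarrow> complex" where
  "tau A = (\<Sum>i<dim_row A. A $$ (i, i)) / of_nat (dim_row A)"

text \<open>
  A refined partition is the list of the pairs (n_i, m_i), the second component being the
  multiplicity; the n_i need not be distinct.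
\<close>

definition refined_partition :: "nat \<Rightarrow> (nat \<times> nat) list \<Rightarrow> bool" where
  "refined_partition n lam \<longleftrightarrow>
     lam \<noteq> [] \<and> (\<forall>(k, m) \<in> set lam. 1 \<le> k \<and> 1 \<le> m) \<and> n = (\<Sum>(k, m)\<leftarrow>lam. m * k)"

text \<open>All matrices diag(A_1, ..., A_1, ..., A_L, ..., A_L) with A_i repeated m_i times.\<close>

definition subalg :: "(nat \<times> nat) list \<Rightarrow> complex mat set" where
  "subalg lam =
     {diag_block_mat (concat (map2 (\<lambda>(k, m) A. replicate m A) lam As)) | As.
        length As = length lam \<and>
        (\<forall>i<length lam. As ! i \<in> carrier_mat (fst (lam ! i)) (fst (lam ! i)))}"

text \<open>
  The trace-preserving conditional expectations of the n by n matrices onto a unital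
  C*-subalgebra B. Matrices of all sizes share one type, so the maps are taken to be
  extensional (undefined off the n by n matrices); without this they could not be unique.
\<close>

definition is_cond_exp :: "nat \<Rightarrow> complex mat set \<Rightarrow> (complex mat \<Rightarrow> complex mat) \<Rightarrow> bool" where
  "is_cond_exp n B P \<longleftrightarrow>
     P \<in> carrier_mat n n \<rightarrow>\<^sub>E B \<and>
     (\<forall>X \<in> carrier_mat n n. \<forall>Y \<in> carrier_mat n n. P (X + Y) = P X + P Y) \<and>
     (\<forall>c. \<forall>X \<in> carrier_mat n n. P (c \<cdot>\<^sub>m X) = c \<cdot>\<^sub>m P X) \<and>
     (\<forall>X \<in> B. P X = X) \<and>
     (\<forall>X \<in> carrier_mat n n. op_norm (P X) \<le> op_norm X) \<and>
     (\<forall>X \<in> carrier_mat n n. tau (P X) = tau X)"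

definition cond_exp :: "nat \<Rightarrow> complex mat set \<Rightarrow> complex mat \<Rightarrow> complex mat" where
  "cond_exp n B = (THE P. is_cond_exp n B P)"

text \<open>The Frobenius--Rieffel norm associated with B.\<close>

definition fr_norm :: "nat \<Rightarrow> complex mat set \<Rightarrow> complex mat \<Rightarrow> real" where
  "fr_norm n B A = sqrt (op_norm (cond_exp n B (mat_adjoint A * A)))"

end

(*
  Let D act on the k-th of the r diagonal blocks as the k-th power of a primitive r-th root of
  unity, and let S permute cyclically, within each summand, the m_i copies of A_i. Then S^l = 1, and
  averaging the r l conjugates D^s S^t X S^-t D^-s kills the off-diagonal blocks and averages the
  copies, so it yields P_B(X). For positive X each term of the average is positive, and the term
  s = t = 0 is X itself; hence X <= r l P_B(X), which gives both inequalities (the second from X* X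
  in place of X).

  That this average is the only trace-preserving conditional expectation P comes from Tomiyama's
  argument: P(e X) = e P(X) for projections e in B, so tau(e P(X)) = tau(e X), and an element of B
  whose products with all projections of B have trace 0 vanishes.
*)

theory Submission imports Defs begin

section \<open>Euclidean norm and operator norm\<close>

text \<open>\<open>cond_exp\<close> is a definite description, so nothing can be said about it
  before existence and uniqueness are both settled. Its defining properties include neither
  positivity nor a bimodule law; from contractivity alone Tomiyama's argument must extract as much
  of that law as the trace can detect. The \<open>r l\<close> unitaries \<open>D^s S^t\<close> are
  not claimed to form a group. That their average lands in the algebra is therefore computed
  entrywise: the phases depend only on \<open>s\<close>, the permuted entries only on
  \<open>t\<close>, and the double sum factors. The factor \<open>r\<close> is the number of phases
  that tells all diagonal blocks apart, copies of one summand included; \<open>l\<close> is a common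
  period of all the rotations, so that each copy in summand \<open>i\<close> is met equally often,
  \<open>l / m_i\<close> times. Norms are reached through quadratic forms. For positive
  \<open>X\<close> the form has to control the norm; in the second inequality the form of
  \<open>X* X\<close> at \<open>v\<close> is already the squared norm of \<open>X v\<close>.\<close>

lemma vec_norm2_nonneg [simp]: "0 \<le> vec_norm2 v"
  by (simp add: vec_norm2_def L2_set_nonneg)

lemma cscalar_prod_sum:
  fixes v w :: "complex vec"
  assumes "dim_vec v = n" "dim_vec w = n"
  shows "v \<bullet>c w = (\<Sum>i<n. v $ i * cnj (w $ i))"
  using assms by (simp add: scalar_prod_def atLeast0LessThan)

lemma cscalar_prod_self: "v \<bullet>c v = complex_of_real ((vec_norm2 v)\<^sup>2)"
proof -
  have "(vec_norm2 v)\<^sup>2 = (\<Sum>i<dim_vec v. (cmod (v $ i))\<^sup>2)"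
    by (simp add: vec_norm2_def L2_set_def sum_nonneg)
  then show ?thesis
    by (simp only: cscalar_prod_sum[OF refl refl] of_real_sum complex_norm_square)
qed

lemma vec_norm2_sq: "(vec_norm2 v)\<^sup>2 = Re (v \<bullet>c v)"
  by (simp add: cscalar_prod_self)

lemma cmod_cscalar_prod_le:
  assumes "dim_vec v = dim_vec w"
  shows "cmod (v \<bullet>c w) \<le> vec_norm2 v * vec_norm2 w"
proof -
  have "cmod (v \<bullet>c w) \<le> (\<Sum>i<dim_vec w. \<bar>cmod (v $ i)\<bar> * \<bar>cmod (w $ i)\<bar>)"
    using norm_sum[of "\<lambda>i. v $ i * cnj (w $ i)" "{..<dim_vec w}"] assms
    by (simp add: cscalar_prod_sum[of v "dim_vec w" w] norm_mult)
  also have "\<dots> \<le> vec_norm2 v * vec_norm2 w"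
    unfolding vec_norm2_def assms by (rule L2_set_mult_ineq)
  finally show ?thesis .
qed

lemma vec_norm2_smult: "vec_norm2 (c \<cdot>\<^sub>v v) = cmod c * vec_norm2 v"
proof -
  have "vec_norm2 (c \<cdot>\<^sub>v v) = L2_set (\<lambda>i. cmod c * cmod (v $ i)) {..<dim_vec v}"
    unfolding vec_norm2_def by (rule L2_set_cong) (auto simp: norm_mult)
  then show ?thesis by (simp add: vec_norm2_def L2_set_right_distrib)
qed

lemma vec_norm2_eq_0_iff: "vec_norm2 v = 0 \<longleftrightarrow> v = 0\<^sub>v (dim_vec v)"
proof -
  have "vec_norm2 v = 0 \<longleftrightarrow> (\<forall>i<dim_vec v. v $ i = 0)"
    by (auto simp: vec_norm2_def L2_set_eq_0_iff)
  also have "\<dots> \<longleftrightarrow> v = 0\<^sub>v (dim_vec v)"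
    by (metis dim_vec index_zero_vec eq_vecI)
  finally show ?thesis .
qed

lemma vec_norm2_0 [simp]: "vec_norm2 (0\<^sub>v n) = 0"
  by (simp add: vec_norm2_eq_0_iff)

lemma mult_mat_vec_smult:
  fixes A :: "complex mat"
  assumes "v \<in> carrier_vec (dim_col A)"
  shows "A *\<^sub>v (c \<cdot>\<^sub>v v) = c \<cdot>\<^sub>v (A *\<^sub>v v)"
  using assms by (intro mult_mat_vec[of _ "dim_row A" "dim_col A"]) auto

text \<open>Cauchy-Schwarz in each row. The Frobenius bound is crude but finite, and that is all it
  is for: \<open>op_norm\<close> is a real \<open>Sup\<close>, meaningless until its set is known to
  be bounded above.\<close>

lemma vec_norm2_mult_mat_le_frobenius:
  assumes "v \<in> carrier_vec (dim_col A)"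
  shows "vec_norm2 (A *\<^sub>v v) \<le> L2_set (\<lambda>i. vec_norm2 (row A i)) {..<dim_row A} * vec_norm2 v"
proof -
  have "vec_norm2 (A *\<^sub>v v) \<le> L2_set (\<lambda>i. vec_norm2 (row A i) * vec_norm2 v) {..<dim_row A}"
    unfolding vec_norm2_def[of "A *\<^sub>v v"] dim_mult_mat_vec
  proof (rule L2_set_mono)
    fix i assume i: "i \<in> {..<dim_row A}"
    \<comment> \<open>Matrix-vector products use the bilinear product, Cauchy-Schwarz the
      sesquilinear one; conjugating \<open>v\<close> mediates at no cost in norm.\<close>
    have n: "vec_norm2 (conjugate v) = vec_norm2 v" unfolding vec_norm2_def by (rule L2_set_cong) auto
    show "cmod ((A *\<^sub>v v) $ i) \<le> vec_norm2 (row A i) * vec_norm2 v"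
      using cmod_cscalar_prod_le[of "row A i" "conjugate v"] i assms by (simp add: n)
  qed auto
  then show ?thesis by (simp add: L2_set_left_distrib)
qed

section \<open>The operator norm as a supremum\<close>

lemma op_norm_bdd_above:
  "bdd_above {vec_norm2 (A *\<^sub>v v) | v. v \<in> carrier_vec (dim_col A) \<and> vec_norm2 v \<le> 1}"
proof (rule bdd_aboveI, clarify)
  fix v assume v: "v \<in> carrier_vec (dim_col A)" "vec_norm2 v \<le> 1"
  show "vec_norm2 (A *\<^sub>v v) \<le> L2_set (\<lambda>i. vec_norm2 (row A i)) {..<dim_row A}"
    using vec_norm2_mult_mat_le_frobenius[OF v(1)] v(2)
    by (meson L2_set_nonneg mult_left_le order_trans)
qed

lemma op_norm_nonneg [simp]: "0 \<le> op_norm A"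
proof -
  have "vec_norm2 (A *\<^sub>v 0\<^sub>v (dim_col A)) \<le> op_norm A"
    unfolding op_norm_def by (rule cSup_upper[OF _ op_norm_bdd_above]) force
  then show ?thesis using vec_norm2_nonneg order_trans by blast
qed

lemma vec_norm2_mult_mat_le:
  assumes v: "v \<in> carrier_vec (dim_col A)"
  shows "vec_norm2 (A *\<^sub>v v) \<le> op_norm A * vec_norm2 v"
proof (cases "vec_norm2 v = 0")
  case True
  then have "v = 0\<^sub>v (dim_col A)" using v by (simp add: vec_norm2_eq_0_iff)
  then have "A *\<^sub>v v = 0\<^sub>v (dim_row A)" by auto
  then show ?thesis by simp
next
  case False
  define c where "c = complex_of_real (1 / vec_norm2 v)"
  have c: "cmod c = 1 / vec_norm2 v" by (simp add: c_def norm_divide)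
  have "vec_norm2 (A *\<^sub>v (c \<cdot>\<^sub>v v)) \<le> op_norm A"
    unfolding op_norm_def
    by (rule cSup_upper[OF _ op_norm_bdd_above]) (use v c False in \<open>auto simp: vec_norm2_smult\<close>)
  then have "vec_norm2 (A *\<^sub>v v) / vec_norm2 v \<le> op_norm A"
    using v c by (simp add: mult_mat_vec_smult vec_norm2_smult)
  then show ?thesis using False vec_norm2_nonneg[of v] by (simp add: divide_le_eq)
qed

lemma op_norm_le:
  assumes "0 \<le> c" "\<And>v. v \<in> carrier_vec (dim_col A) \<Longrightarrow> vec_norm2 (A *\<^sub>v v) \<le> c * vec_norm2 v"
  shows "op_norm A \<le> c"
  unfolding op_norm_def
proof (rule cSup_least)
  have "vec_norm2 (A *\<^sub>v 0\<^sub>v (dim_col A)) \<in>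
      {vec_norm2 (A *\<^sub>v v) |v. v \<in> carrier_vec (dim_col A) \<and> vec_norm2 v \<le> 1}"
    by force
  then show "{vec_norm2 (A *\<^sub>v v) |v. v \<in> carrier_vec (dim_col A) \<and> vec_norm2 v \<le> 1} \<noteq> {}"
    by blast
next
  fix t assume "t \<in> {vec_norm2 (A *\<^sub>v v) |v. v \<in> carrier_vec (dim_col A) \<and> vec_norm2 v \<le> 1}"
  then obtain v where v: "t = vec_norm2 (A *\<^sub>v v)" "v \<in> carrier_vec (dim_col A)" "vec_norm2 v \<le> 1"
    by blast
  have "t \<le> c * vec_norm2 v" using assms(2) v by simp
  also have "\<dots> \<le> c" using v assms(1) by (simp add: mult_left_le)
  finally show "t \<le> c" .
qed

lemma op_norm_eq_0:
  assumes A: "A \<in> carrier_mat n m" and "op_norm A = 0"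
  shows "A = 0\<^sub>m n m"
proof (rule eq_matI)
  fix i j assume ij: "i < dim_row (0\<^sub>m n m :: complex mat)" "j < dim_col (0\<^sub>m n m :: complex mat)"
  have "vec_norm2 (A *\<^sub>v unit_vec m j) = 0"
    using vec_norm2_mult_mat_le[of "unit_vec m j" A] assms
    by (metis carrier_matD(2) mult_zero_left order_antisym unit_vec_carrier vec_norm2_nonneg)
  moreover have "A *\<^sub>v unit_vec m j = col A j"
    using A ij by (intro eq_vecI) auto
  ultimately have "col A j = 0\<^sub>v n" using A by (simp add: vec_norm2_eq_0_iff)
  then have "col A j $ i = 0" using ij by simp
  then show "A $$ (i, j) = 0\<^sub>m n m $$ (i, j)" using A ij by simp
qed (use A in auto)

lemma op_norm_smult: "op_norm (c \<cdot>\<^sub>m A) = cmod c * op_norm A"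
proof -
  have le: "op_norm (c \<cdot>\<^sub>m A) \<le> cmod c * op_norm A" for c A
  proof (rule op_norm_le)
    fix v :: "complex vec" assume v: "v \<in> carrier_vec (dim_col (c \<cdot>\<^sub>m A))"
    have "(c \<cdot>\<^sub>m A) *\<^sub>v v = c \<cdot>\<^sub>v (A *\<^sub>v v)"
      using v by (intro eq_vecI) (auto simp: scalar_prod_def sum_distrib_left ac_simps)
    then show "vec_norm2 ((c \<cdot>\<^sub>m A) *\<^sub>v v) \<le> cmod c * op_norm A * vec_norm2 v"
      using vec_norm2_mult_mat_le[of v A] v by (simp add: vec_norm2_smult mult_left_mono mult.assoc)
  qed simp
  show ?thesis
  proof (cases "c = 0")
    case True
    then show ?thesis using le[of c A] by (simp add: order_antisym)
  next
    case False
    have "A = inverse c \<cdot>\<^sub>m (c \<cdot>\<^sub>m A)"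
      using False by (intro eq_matI) auto
    then have "op_norm A \<le> inverse (cmod c) * op_norm (c \<cdot>\<^sub>m A)"
      using le[of "inverse c" "c \<cdot>\<^sub>m A"] by (simp add: norm_inverse)
    then show ?thesis using le[of c A] False by (simp add: field_simps)
  qed
qed

section \<open>Adjoints and sesquilinear forms\<close>

lemma dim_mat_adjoint [simp]: "dim_row (mat_adjoint A) = dim_col A" "dim_col (mat_adjoint A) = dim_row A"
  by (simp_all add: mat_adjoint_def)

lemma mat_adjoint_carrier [simp]: "mat_adjoint A \<in> carrier_mat n m \<longleftrightarrow> A \<in> carrier_mat m n"
  unfolding carrier_mat_def by auto

lemma index_mat_adjoint [simp]:
  fixes A :: "complex mat"
  assumes "i < dim_col A" "j < dim_row A"
  shows "mat_adjoint A $$ (i, j) = cnj (A $$ (j, i))"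
proof -
  have "mat_adjoint A $$ (i, j) = map conjugate (cols A) ! i $ j"
    unfolding mat_adjoint_def by (rule mat_of_rows_index) (use assms in auto)
  then show ?thesis using assms by simp
qed

text \<open>The form as a double sum over entries: here sums can be swapped (for the adjoint) and
  both indices permuted (for conjugation by monomial matrices).\<close>

lemma cscalar_prod_mult_mat_sum:
  fixes A :: "complex mat"
  assumes "A \<in> carrier_mat n m" "v \<in> carrier_vec m" "w \<in> carrier_vec n"
  shows "(A *\<^sub>v v) \<bullet>c w = (\<Sum>x<n. \<Sum>y<m. A $$ (x, y) * v $ y * cnj (w $ x))"
proof -
  have "(A *\<^sub>v v) $ x * cnj (w $ x) = (\<Sum>y<m. A $$ (x, y) * v $ y * cnj (w $ x))" if "x < n" for x
    using assms that by (simp add: scalar_prod_def atLeast0LessThan sum_distrib_right)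
  then show ?thesis using assms by (simp add: cscalar_prod_sum[of _ n])
qed

lemma cscalar_prod_mat_adjoint:
  fixes A :: "complex mat"
  assumes "A \<in> carrier_mat n m" "v \<in> carrier_vec m" "w \<in> carrier_vec n"
  shows "(A *\<^sub>v v) \<bullet>c w = v \<bullet>c (mat_adjoint A *\<^sub>v w)"
proof -
  have *: "v $ y * cnj ((mat_adjoint A *\<^sub>v w) $ y) = (\<Sum>x<n. A $$ (x, y) * v $ y * cnj (w $ x))" if "y < m" for y
    using assms that
    by (simp add: scalar_prod_def atLeast0LessThan sum_distrib_left ac_simps)
  have "v \<bullet>c (mat_adjoint A *\<^sub>v w) = (\<Sum>y<m. \<Sum>x<n. A $$ (x, y) * v $ y * cnj (w $ x))"
    using assms * by (simp add: cscalar_prod_sum[of _ m])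
  also have "\<dots> = (\<Sum>x<n. \<Sum>y<m. A $$ (x, y) * v $ y * cnj (w $ x))"
    by (rule sum.swap)
  finally show ?thesis
    using assms by (simp only: cscalar_prod_mult_mat_sum[of A n m])
qed

lemma cscalar_prod_commute:
  fixes v w :: "complex vec"
  assumes "dim_vec v = dim_vec w"
  shows "w \<bullet>c v = cnj (v \<bullet>c w)"
proof -
  have "w \<bullet>c v = (\<Sum>i<dim_vec w. w $ i * cnj (v $ i))"
    by (rule cscalar_prod_sum[OF refl assms])
  moreover have "v \<bullet>c w = (\<Sum>i<dim_vec w. v $ i * cnj (w $ i))"
    by (rule cscalar_prod_sum[OF assms refl])
  ultimately show ?thesis by (simp add: mult.commute)
qed

lemma vec_norm2_add_sq:
  assumes "dim_vec v = dim_vec w"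
  shows "(vec_norm2 (v + w))\<^sup>2 = (vec_norm2 v)\<^sup>2 + 2 * Re (v \<bullet>c w) + (vec_norm2 w)\<^sup>2"
proof -
  have v: "v \<in> carrier_vec (dim_vec w)" and w: "w \<in> carrier_vec (dim_vec w)"
    by (rule carrier_vecI, rule assms) (rule carrier_vecI, rule refl)
  have "(v + w) \<bullet>c (v + w) = v \<bullet>c v + v \<bullet>c w + (w \<bullet>c v + w \<bullet>c w)"
  proof -
    have cv: "conjugate v \<in> carrier_vec (dim_vec w)" and cw: "conjugate w \<in> carrier_vec (dim_vec w)"
      by (rule carrier_vec_conjugate[OF v], rule carrier_vec_conjugate[OF w])
    show ?thesis
      unfolding conjugate_add_vec[OF v w] add_scalar_prod_distrib[OF v w add_carrier_vec[OF cv cw]]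
        scalar_prod_add_distrib[OF v cv cw] scalar_prod_add_distrib[OF w cv cw] ..
  qed
  then have "Re ((v + w) \<bullet>c (v + w)) = Re (v \<bullet>c v) + 2 * Re (v \<bullet>c w) + Re (w \<bullet>c w)"
    unfolding cscalar_prod_commute[OF assms] by simp
  then show ?thesis by (simp only: vec_norm2_sq)
qed

text \<open>Expanding the form at \<open>v - t X v\<close> with \<open>t = 1/c\<close> replaces the numerical radius
  argument for positive matrices.\<close>

lemma op_norm_psd_le:
  assumes X: "X \<in> carrier_mat n n" "psd X" and c: "0 \<le> c"
    and form: "\<And>v. v \<in> carrier_vec n \<Longrightarrow> Re ((X *\<^sub>v v) \<bullet>c v) \<le> c * (vec_norm2 v)\<^sup>2"
  shows "op_norm X \<le> c"
proof (rule field_le_epsilon)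
  fix e :: real assume e: "0 < e"
  \<comment> \<open>The argument divides by the bound, and \<open>c\<close> may be zero; enlarging
    it by an arbitrary \<open>e\<close> makes it positive.\<close>
  define d where "d = c + e"
  have d: "0 < d" using c e by (simp add: d_def)
  have form': "Re ((X *\<^sub>v v) \<bullet>c v) \<le> d * (vec_norm2 v)\<^sup>2" if "v \<in> carrier_vec n" for v
    using form[OF that] e by (simp add: d_def algebra_simps add_increasing2)
  show "op_norm X \<le> c + e"
    unfolding d_def[symmetric]
  proof (rule op_norm_le)
    fix u :: "complex vec" assume "u \<in> carrier_vec (dim_col X)"
    then have u: "u \<in> carrier_vec n" using X by simp
    define w where "w = X *\<^sub>v u"
    define z where "z = complex_of_real (- 1 / d) \<cdot>\<^sub>v w"
    have w: "w \<in> carrier_vec n" and z: "z \<in> carrier_vec n" using X u by (auto simp: w_def z_def)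
    have adj: "mat_adjoint X = X" using X by (simp add: psd_def)
    have Xz: "X *\<^sub>v z = complex_of_real (- 1 / d) \<cdot>\<^sub>v (X *\<^sub>v w)"
      using X w by (simp add: z_def mult_mat_vec_smult)
    have wz: "Re (w \<bullet>c z) = - (vec_norm2 w)\<^sup>2 / d"
      by (simp add: z_def conjugate_smult_vec cscalar_prod_self)
    have "(X *\<^sub>v z) \<bullet>c u = z \<bullet>c w"
      using cscalar_prod_mat_adjoint[of X n n z u] X z u adj by (simp add: w_def)
    then have zu: "Re ((X *\<^sub>v z) \<bullet>c u) = - (vec_norm2 w)\<^sup>2 / d"
      using wz cscalar_prod_commute[of w z] w z by simp
    have nz: "(vec_norm2 z)\<^sup>2 = (vec_norm2 w)\<^sup>2 / d\<^sup>2"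
      using d by (simp add: z_def vec_norm2_smult norm_divide power_mult_distrib power_divide)
    have "0 \<le> Re ((X *\<^sub>v (u + z)) \<bullet>c (u + z))"
      using X u z by (simp add: psd_def)
    also have "(X *\<^sub>v (u + z)) \<bullet>c (u + z)
        = (X *\<^sub>v u) \<bullet>c u + w \<bullet>c z + (X *\<^sub>v z) \<bullet>c u + (X *\<^sub>v z) \<bullet>c z"
      using X u z
      by (simp add: mult_add_distrib_mat_vec[of X n n] conjugate_add_vec[of _ n] w_def
          add_scalar_prod_distrib[of _ n] scalar_prod_add_distrib[of _ n])
    finally have "0 \<le> Re ((X *\<^sub>v u) \<bullet>c u) - 2 * (vec_norm2 w)\<^sup>2 / d + Re ((X *\<^sub>v z) \<bullet>c z)"
      using wz zu by simp
    \<comment> \<open>The form bound is used twice, at \<open>u\<close> and at \<open>z\<close>.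
      Since \<open>z\<close> is \<open>w\<close> scaled by \<open>- 1 / d\<close>, the second use
      gives back only half of the negative term.\<close>
    also have "\<dots> \<le> d * (vec_norm2 u)\<^sup>2 - 2 * (vec_norm2 w)\<^sup>2 / d + d * ((vec_norm2 w)\<^sup>2 / d\<^sup>2)"
      using form'[OF u] form'[OF z] by (simp add: nz)
    finally have "(vec_norm2 w)\<^sup>2 \<le> (d * vec_norm2 u)\<^sup>2"
      using d by (simp add: field_simps power2_eq_square)
    then show "vec_norm2 (X *\<^sub>v u) \<le> d * vec_norm2 u"
      unfolding w_def by (rule power2_le_imp_le) (use d in simp)
  qed (use d in simp)
qed

section \<open>Conditional expectations and projections\<close>

text \<open>For a self-adjoint idempotent, the squared norm of \<open>q a\<close> is the inner
  product of \<open>a\<close> with \<open>q a\<close>; Cauchy-Schwarz then allows one factor to be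
  cancelled.\<close>

lemma op_norm_mult_projection_le:
  assumes q: "q \<in> carrier_mat n n" "mat_adjoint q = q" "q * q = q" and Y: "Y \<in> carrier_mat n n"
  shows "op_norm (q * Y) \<le> op_norm Y"
proof (rule op_norm_le)
  fix v :: "complex vec" assume "v \<in> carrier_vec (dim_col (q * Y))"
  then have v: "v \<in> carrier_vec n" using Y by simp
  define a where "a = Y *\<^sub>v v"
  define b where "b = q *\<^sub>v a"
  have a: "a \<in> carrier_vec n" and b: "b \<in> carrier_vec n"
    unfolding a_def b_def using q Y v by simp_all
  have "q *\<^sub>v b = b"
    unfolding b_def using assoc_mult_mat_vec[OF q(1) q(1) a] by (simp add: q)
  then have "b \<bullet>c b = a \<bullet>c b"
    using cscalar_prod_mat_adjoint[OF q(1) a b] by (simp add: q b_def)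
  then have "(vec_norm2 b)\<^sup>2 = Re (a \<bullet>c b)" by (simp add: vec_norm2_sq)
  also have "\<dots> \<le> vec_norm2 a * vec_norm2 b"
    using cmod_cscalar_prod_le[of a b] complex_Re_le_cmod[of "a \<bullet>c b"] a b by simp
  finally have "vec_norm2 b \<le> vec_norm2 a"
    by (metis mult_right_le_imp_le order_le_less power2_eq_square vec_norm2_nonneg)
  moreover have "(q * Y) *\<^sub>v v = b"
    unfolding a_def b_def by (rule assoc_mult_mat_vec[OF q(1) Y v])
  moreover have "vec_norm2 a \<le> op_norm Y * vec_norm2 v"
    unfolding a_def by (rule vec_norm2_mult_mat_le) (use Y v in simp)
  ultimately show "vec_norm2 ((q * Y) *\<^sub>v v) \<le> op_norm Y * vec_norm2 v" by simp
qed simp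

text \<open>The hypothesis makes the ranges of \<open>A\<close> and \<open>C\<close> orthogonal, so
  Pythagoras applies at every vector. In Tomiyama's argument this rules out a term linear in
  \<open>t\<close> on the upper side.\<close>

lemma op_norm_orthogonal_add_sq_le:
  assumes A: "A \<in> carrier_mat n n" and C: "C \<in> carrier_mat n n" and orth: "mat_adjoint A * C = 0\<^sub>m n n"
  shows "(op_norm (A + C))\<^sup>2 \<le> (op_norm A)\<^sup>2 + (op_norm C)\<^sup>2"
proof -
  define s where "s = sqrt ((op_norm A)\<^sup>2 + (op_norm C)\<^sup>2)"
  have s: "s\<^sup>2 = (op_norm A)\<^sup>2 + (op_norm C)\<^sup>2" "0 \<le> s" by (simp_all add: s_def)
  have "op_norm (A + C) \<le> s"
  proof (rule op_norm_le)
    fix v :: "complex vec" assume "v \<in> carrier_vec (dim_col (A + C))"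
    then have v: "v \<in> carrier_vec n" using C by simp
    have Av: "A *\<^sub>v v \<in> carrier_vec n" and Cv: "C *\<^sub>v v \<in> carrier_vec n" using A C v by simp_all
    have adj: "mat_adjoint A \<in> carrier_mat n n" using A by simp
    have "(A *\<^sub>v v) \<bullet>c (C *\<^sub>v v) = v \<bullet>c (0\<^sub>m n n *\<^sub>v v)"
      unfolding cscalar_prod_mat_adjoint[OF A v Cv] assoc_mult_mat_vec[OF adj C v, symmetric] orth ..
    also have "0\<^sub>m n n *\<^sub>v v = 0\<^sub>v n" using v by (intro eq_vecI) (simp_all add: scalar_prod_def)
    finally have "(A *\<^sub>v v) \<bullet>c (C *\<^sub>v v) = 0" using v by simp
    then have "(vec_norm2 ((A + C) *\<^sub>v v))\<^sup>2 = (vec_norm2 (A *\<^sub>v v))\<^sup>2 + (vec_norm2 (C *\<^sub>v v))\<^sup>2"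
      using vec_norm2_add_sq[of "A *\<^sub>v v" "C *\<^sub>v v"] Av Cv add_mult_distrib_mat_vec[OF A C v] A C by simp
    also have "\<dots> \<le> (op_norm A * vec_norm2 v)\<^sup>2 + (op_norm C * vec_norm2 v)\<^sup>2"
      using vec_norm2_mult_mat_le[of v A] vec_norm2_mult_mat_le[of v C] v A C
      by (intro add_mono power_mono) simp_all
    also have "\<dots> = (s * vec_norm2 v)\<^sup>2"
      by (simp add: power_mult_distrib s(1) algebra_simps)
    finally show "vec_norm2 ((A + C) *\<^sub>v v) \<le> s * vec_norm2 v"
      by (rule power2_le_imp_le) (simp add: s(2))
  qed (rule s(2))
  then have "(op_norm (A + C))\<^sup>2 \<le> s\<^sup>2" by (intro power_mono) simp_all
  then show ?thesis by (simp only: s(1))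
qed

lemma is_cond_expD:
  assumes "is_cond_exp n B P"
  shows is_cond_exp_mem: "X \<in> carrier_mat n n \<Longrightarrow> P X \<in> B"
    and is_cond_exp_add: "X \<in> carrier_mat n n \<Longrightarrow> Y \<in> carrier_mat n n \<Longrightarrow> P (X + Y) = P X + P Y"
    and is_cond_exp_smult: "X \<in> carrier_mat n n \<Longrightarrow> P (c \<cdot>\<^sub>m X) = c \<cdot>\<^sub>m P X"
    and is_cond_exp_fix: "X \<in> B \<Longrightarrow> P X = X"
    and is_cond_exp_le: "X \<in> carrier_mat n n \<Longrightarrow> op_norm (P X) \<le> op_norm X"
    and is_cond_exp_tau: "X \<in> carrier_mat n n \<Longrightarrow> tau (P X) = tau X"
    and is_cond_exp_undefined: "X \<notin> carrier_mat n n \<Longrightarrow> P X = undefined"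
  using assms unfolding is_cond_exp_def by (blast, blast, blast, blast, blast, blast, blast dest: PiE_arb)

text \<open>Tomiyama's perturbation argument: with \<open>D = q P (e X)\<close> the contraction \<open>q P\<close> maps
  \<open>e X + t D\<close> to \<open>(1 + t) D\<close>, whereas the norm of \<open>e X + t D\<close> only grows like that of \<open>t D\<close>.\<close>

lemma cond_exp_complementary_projections:
  assumes P: "is_cond_exp n B P" and B: "B \<subseteq> carrier_mat n n"
    and e: "e \<in> carrier_mat n n" "mat_adjoint e = e"
    and q: "q \<in> carrier_mat n n" "mat_adjoint q = q" "q * q = q"
    and eq: "e * q = 0\<^sub>m n n"
    and closed: "\<And>A. A \<in> B \<Longrightarrow> q * A \<in> B"
    and X: "X \<in> carrier_mat n n"
  shows "q * P (e * X) = 0\<^sub>m n n"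
proof -
  note Pm = is_cond_exp_mem[OF P] and Padd = is_cond_exp_add[OF P] and Psm = is_cond_exp_smult[OF P]
    and Pfix = is_cond_exp_fix[OF P] and Ple = is_cond_exp_le[OF P]
  define Y where "Y = e * X"
  define D where "D = q * P Y"
  define d where "d = op_norm D"
  have Y: "Y \<in> carrier_mat n n" using e X by (simp add: Y_def)
  then have PY: "P Y \<in> carrier_mat n n" using Pm B by blast
  have DB: "D \<in> B" unfolding D_def by (rule closed[OF Pm[OF Y]])
  then have D: "D \<in> carrier_mat n n" using B by blast
  have qD: "q * D = D"
    unfolding D_def assoc_mult_mat[OF q(1) q(1) PY, symmetric] q(3) ..
  have orth: "mat_adjoint Y * (c \<cdot>\<^sub>m D) = 0\<^sub>m n n" for c
  proof -
    have adjY: "mat_adjoint Y = mat_adjoint X * e"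
    proof (rule eq_matI)
      fix i j assume ij: "i < dim_row (mat_adjoint X * e)" "j < dim_col (mat_adjoint X * e)"
      have "cnj (e $$ (j, k)) = e $$ (k, j)" if "k < n" for k
        using index_mat_adjoint[of k e j] e that ij by simp
      then show "mat_adjoint Y $$ (i, j) = (mat_adjoint X * e) $$ (i, j)"
        using ij e X by (simp add: Y_def scalar_prod_def mult.commute)
    qed (use e X in \<open>simp_all add: Y_def\<close>)
    have aX: "mat_adjoint X \<in> carrier_mat n n" using X by simp
    have "mat_adjoint Y * D = mat_adjoint X * (e * (q * P Y))"
      unfolding adjY D_def[symmetric] by (rule assoc_mult_mat[OF aX e(1) D])
    also have "e * (q * P Y) = 0\<^sub>m n n"
      unfolding assoc_mult_mat[OF e(1) q(1) PY, symmetric] eq using PY by simp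
    finally have "mat_adjoint Y * D = 0\<^sub>m n n" using aX by simp
    then show ?thesis
      using mult_smult_distrib[of "mat_adjoint Y" n n D n c] Y D by simp
  qed
  \<comment> \<open>The left side is the squared norm of \<open>q P (Y + t D)\<close>:
    \<open>P\<close> fixes \<open>D\<close> because it lies in \<open>B\<close>, and
    \<open>q D = D\<close>. The terms in \<open>t^2\<close> cancel between the two sides, leaving a
    linear term on the left only.\<close>
  have grow: "(1 + t)\<^sup>2 * d\<^sup>2 \<le> (op_norm Y)\<^sup>2 + t\<^sup>2 * d\<^sup>2" if t: "0 \<le> t" for t :: real
  proof -
    define c where "c = complex_of_real t"
    have cD: "c \<cdot>\<^sub>m D \<in> carrier_mat n n" using D by simp
    have S: "Y + c \<cdot>\<^sub>m D \<in> carrier_mat n n" using Y D by simp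
    have "q * P (Y + c \<cdot>\<^sub>m D) = q * P Y + q * (c \<cdot>\<^sub>m D)"
      unfolding Padd[OF Y cD] Psm[OF D] Pfix[OF DB] by (rule mult_add_distrib_mat[OF q(1) PY cD])
    also have "q * (c \<cdot>\<^sub>m D) = c \<cdot>\<^sub>m D"
      using mult_smult_distrib[OF q(1) D] by (simp add: qD)
    also have "q * P Y + c \<cdot>\<^sub>m D = (1 + c) \<cdot>\<^sub>m D"
      unfolding D_def[symmetric] using D by (intro eq_matI) (simp_all add: algebra_simps)
    finally have "op_norm (q * P (Y + c \<cdot>\<^sub>m D)) = cmod (1 + c) * d"
      by (simp only: op_norm_smult d_def)
    moreover have "1 + c = complex_of_real (1 + t)" by (simp add: c_def)
    then have "cmod (1 + c) = 1 + t" using t by (simp only: norm_of_real)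
    ultimately have "op_norm (q * P (Y + c \<cdot>\<^sub>m D)) = (1 + t) * d" by (simp only:)
    moreover have "op_norm (q * P (Y + c \<cdot>\<^sub>m D)) \<le> op_norm (P (Y + c \<cdot>\<^sub>m D))"
      by (rule op_norm_mult_projection_le[OF q]) (use Pm[OF S] B in blast)
    moreover have "op_norm (P (Y + c \<cdot>\<^sub>m D)) \<le> op_norm (Y + c \<cdot>\<^sub>m D)" by (rule Ple[OF S])
    ultimately have "((1 + t) * d)\<^sup>2 \<le> (op_norm (Y + c \<cdot>\<^sub>m D))\<^sup>2"
      using t by (intro power_mono) (simp_all add: d_def)
    also have "\<dots> \<le> (op_norm Y)\<^sup>2 + (op_norm (c \<cdot>\<^sub>m D))\<^sup>2"
      by (rule op_norm_orthogonal_add_sq_le[OF Y cD orth])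
    also have "\<dots> = (op_norm Y)\<^sup>2 + t\<^sup>2 * d\<^sup>2"
      by (simp add: op_norm_smult d_def c_def power_mult_distrib)
    finally show ?thesis by (simp add: power_mult_distrib)
  qed
  have "d = 0"
  proof (rule ccontr)
    assume "d \<noteq> 0"
    then have d: "0 < d\<^sup>2" by simp
    \<comment> \<open>Chosen so that the linear term \<open>2 t d^2\<close> is twice the squared
      norm of \<open>Y\<close>, which the right side cannot match.\<close>
    define t where "t = (op_norm Y)\<^sup>2 / d\<^sup>2"
    have "d\<^sup>2 + 2 * (t * d\<^sup>2) \<le> (op_norm Y)\<^sup>2"
      using grow[of t] d by (simp add: t_def power2_sum algebra_simps)
    moreover have "t * d\<^sup>2 = (op_norm Y)\<^sup>2" using d by (simp add: t_def)
    moreover have "0 \<le> (op_norm Y)\<^sup>2" by simp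
    ultimately show False using d by linarith
  qed
  then show ?thesis using op_norm_eq_0[OF D] by (simp add: d_def D_def Y_def)
qed

lemma one_minus_projection:
  fixes e :: "complex mat"
  assumes e: "e \<in> carrier_mat n n" "mat_adjoint e = e" "e * e = e"
  defines "q \<equiv> 1\<^sub>m n - e"
  shows "q \<in> carrier_mat n n" "mat_adjoint q = q" "q * q = q" "e * q = 0\<^sub>m n n" "q * e = 0\<^sub>m n n"
    "e + q = 1\<^sub>m n"
proof -
  show q: "q \<in> carrier_mat n n" unfolding q_def by (rule minus_carrier_mat[OF e(1)])
  show eq: "e * q = 0\<^sub>m n n"
    unfolding q_def mult_minus_distrib_mat[OF e(1) one_carrier_mat e(1)] e(3) using e by simp
  show "q * e = 0\<^sub>m n n"
    unfolding q_def minus_mult_distrib_mat[OF one_carrier_mat e(1) e(1)] e(3) using e by simp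
  have "q * q = 1\<^sub>m n * q - e * q"
    by (subst (1) q_def) (rule minus_mult_distrib_mat[OF one_carrier_mat e(1) q])
  also have "\<dots> = q" unfolding eq using q by (intro eq_matI) simp_all
  finally show "q * q = q" .
  show "e + q = 1\<^sub>m n" using e by (intro eq_matI) (simp_all add: q_def)
  show "mat_adjoint q = q"
  proof (rule eq_matI)
    fix i j assume ij: "i < dim_row q" "j < dim_col q"
    have "cnj (e $$ (j, i)) = e $$ (i, j)"
      using index_mat_adjoint[of i e j] e q ij by simp
    then show "mat_adjoint q $$ (i, j) = q $$ (i, j)"
      using ij e q by (simp add: q_def)
  qed (use q in simp_all)
qed

text \<open>With \<open>q = 1 - e\<close>, the preceding vanishing result holds for
  \<open>(e, q)\<close> and for \<open>(q, e)\<close>: \<open>P\<close> respects both parts of the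
  splitting \<open>X = e X + q X\<close>, which is the module law for \<open>e\<close>.\<close>

lemma cond_exp_mult_projection:
  assumes P: "is_cond_exp n B P" and B: "B \<subseteq> carrier_mat n n"
    and e: "e \<in> carrier_mat n n" "mat_adjoint e = e" "e * e = e"
    and closed: "\<And>A. A \<in> B \<Longrightarrow> e * A \<in> B" "\<And>A. A \<in> B \<Longrightarrow> (1\<^sub>m n - e) * A \<in> B"
    and X: "X \<in> carrier_mat n n"
  shows "P (e * X) = e * P X"
proof -
  define q where "q = 1\<^sub>m n - e"
  note q = one_minus_projection[OF e, folded q_def]
  have eX: "e * X \<in> carrier_mat n n" and qX: "q * X \<in> carrier_mat n n" using e q X by simp_all
  have C: "P Y \<in> carrier_mat n n" if "Y \<in> carrier_mat n n" for Y
    using is_cond_exp_mem[OF P that] B by blast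
  have 1: "q * P (e * X) = 0\<^sub>m n n"
    by (rule cond_exp_complementary_projections[OF P B e(1,2) q(1-4) closed(2)[folded q_def] X])
  have 2: "e * P (q * X) = 0\<^sub>m n n"
    by (rule cond_exp_complementary_projections[OF P B q(1,2) e q(5) closed(1) X])
  have "X = e * X + q * X"
    using add_mult_distrib_mat[OF e(1) q(1) X] q(6) X by simp
  then have "P X = P (e * X) + P (q * X)"
    using is_cond_exp_add[OF P eX qX] by simp
  then have "e * P X = e * P (e * X) + e * P (q * X)"
    using mult_add_distrib_mat[OF e(1) C[OF eX] C[OF qX]] by simp
  \<comment> \<open>Both second summands are zero, so one may replace the other; this completes
    \<open>e\<close> to the identity in front of \<open>P (e * X)\<close>.\<close>
  also have "\<dots> = e * P (e * X) + q * P (e * X)"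
    unfolding 1 2 ..
  also have "\<dots> = (e + q) * P (e * X)"
    by (rule add_mult_distrib_mat[OF e(1) q(1) C[OF eX], symmetric])
  also have "\<dots> = P (e * X)" unfolding q(6) using C[OF eX] by simp
  finally show ?thesis ..
qed

section \<open>Averages over monomial unitaries\<close>

text \<open>Let \<open>W\<close> be the monomial matrix whose row \<open>x\<close> has its only
  nonzero entry, \<open>u x\<close>, in column \<open>p x\<close>. This is the entry of
  \<open>W X W*\<close> at \<open>(x, y)\<close>; written entrywise, it involves no inverse of
  \<open>p\<close>.\<close>

definition twist :: "(nat \<Rightarrow> complex) \<Rightarrow> (nat \<Rightarrow> nat) \<Rightarrow> complex mat \<Rightarrow> nat \<Rightarrow> nat \<Rightarrow> complex" where
  "twist u p X x y = u x * cnj (u y) * X $$ (p x, p y)"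

text \<open>\<open>J\<close> is a bare index set without group structure, so invariance of the
  average does not come for free and has to be established in each instance.\<close>

definition monomial_avg ::
    "nat \<Rightarrow> 'j set \<Rightarrow> ('j \<Rightarrow> nat \<Rightarrow> complex) \<Rightarrow> ('j \<Rightarrow> nat \<Rightarrow> nat) \<Rightarrow> complex mat \<Rightarrow> complex mat" where
  "monomial_avg n J u p X = mat n n (\<lambda>(x, y). (\<Sum>j\<in>J. twist (u j) (p j) X x y) / of_nat (card J))"

text \<open>The vector \<open>W* v\<close>, for the monomial matrix \<open>W\<close> behind
  \<open>twist\<close>.\<close>

definition pull_vec :: "nat \<Rightarrow> (nat \<Rightarrow> complex) \<Rightarrow> (nat \<Rightarrow> nat) \<Rightarrow> complex vec \<Rightarrow> complex vec" where
  "pull_vec n u p v = vec n (\<lambda>x. cnj (u (inv_into {..<n} p x)) * v $ inv_into {..<n} p x)"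

lemma pull_vec_carrier [simp]: "pull_vec n u p v \<in> carrier_vec n"
  by (simp add: pull_vec_def)

lemma pull_vec_index:
  assumes "bij_betw p {..<n} {..<n}" "x < n"
  shows "pull_vec n u p v $ p x = cnj (u x) * v $ x"
proof -
  have "p x < n" using assms bij_betwE by blast
  moreover have "inv_into {..<n} p (p x) = x"
    using assms by (simp add: bij_betw_inv_into_left)
  ultimately show ?thesis by (simp add: pull_vec_def)
qed

lemma vec_norm2_pull_vec:
  assumes p: "bij_betw p {..<n} {..<n}" and u: "\<And>x. x < n \<Longrightarrow> cmod (u x) = 1"
    and v: "v \<in> carrier_vec n"
  shows "vec_norm2 (pull_vec n u p v) = vec_norm2 v"
proof -
  have "(\<Sum>x<n. (cmod (pull_vec n u p v $ x))\<^sup>2) = (\<Sum>x<n. (cmod (pull_vec n u p v $ p x))\<^sup>2)"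
    by (rule sum.reindex_bij_betw[OF p, symmetric])
  also have "\<dots> = (\<Sum>x<n. (cmod (v $ x))\<^sup>2)"
    by (rule sum.cong) (simp_all add: pull_vec_index[OF p] norm_mult u)
  finally show ?thesis
    using v carrier_vecD[OF pull_vec_carrier[of n u p v]] carrier_vecD[OF v]
    by (simp only: vec_norm2_def L2_set_def)
qed

text \<open>Moves \<open>W\<close> and \<open>W*\<close> from the matrix to the vectors, by
  reindexing rows and columns along \<open>p\<close>.\<close>

lemma twist_form:
  assumes p: "bij_betw p {..<n} {..<n}"
    and X: "X \<in> carrier_mat n n" and v: "v \<in> carrier_vec n" and w: "w \<in> carrier_vec n"
  shows "(\<Sum>x<n. \<Sum>y<n. twist u p X x y * v $ y * cnj (w $ x))
    = (X *\<^sub>v pull_vec n u p v) \<bullet>c pull_vec n u p w"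
proof -
  let ?g = "\<lambda>x y. X $$ (x, y) * pull_vec n u p v $ y * cnj (pull_vec n u p w $ x)"
  have "(X *\<^sub>v pull_vec n u p v) \<bullet>c pull_vec n u p w = (\<Sum>x<n. \<Sum>y<n. ?g x y)"
    by (rule cscalar_prod_mult_mat_sum[OF X]) simp_all
  also have "\<dots> = (\<Sum>x<n. \<Sum>y<n. ?g (p x) y)"
    by (rule sum.reindex_bij_betw[OF p, symmetric])
  also have "\<dots> = (\<Sum>x<n. \<Sum>y<n. ?g (p x) (p y))"
    by (intro sum.cong refl sum.reindex_bij_betw[OF p, symmetric])
  also have "\<dots> = (\<Sum>x<n. \<Sum>y<n. twist u p X x y * v $ y * cnj (w $ x))"
    by (intro sum.cong refl) (simp add: pull_vec_index[OF p] twist_def)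
  finally show ?thesis ..
qed

lemma monomial_avg_carrier [simp]: "monomial_avg n J u p X \<in> carrier_mat n n"
  by (simp add: monomial_avg_def)

lemma monomial_avg_index:
  "x < n \<Longrightarrow> y < n \<Longrightarrow>
    monomial_avg n J u p X $$ (x, y) = (\<Sum>j\<in>J. twist (u j) (p j) X x y) / of_nat (card J)"
  by (simp add: monomial_avg_def)

lemma monomial_avg_form:
  assumes p: "\<And>j. j \<in> J \<Longrightarrow> bij_betw (p j) {..<n} {..<n}"
    and X: "X \<in> carrier_mat n n" and v: "v \<in> carrier_vec n" and w: "w \<in> carrier_vec n"
  shows "(monomial_avg n J u p X *\<^sub>v v) \<bullet>c w
    = (\<Sum>j\<in>J. (X *\<^sub>v pull_vec n (u j) (p j) v) \<bullet>c pull_vec n (u j) (p j) w) / of_nat (card J)"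
proof -
  have "(monomial_avg n J u p X *\<^sub>v v) \<bullet>c w
      = (\<Sum>x<n. \<Sum>y<n. monomial_avg n J u p X $$ (x, y) * v $ y * cnj (w $ x))"
    by (rule cscalar_prod_mult_mat_sum[OF _ v w]) simp
  also have "\<dots> = (\<Sum>x<n. \<Sum>y<n. \<Sum>j\<in>J. twist (u j) (p j) X x y * v $ y * cnj (w $ x) / of_nat (card J))"
    by (intro sum.cong refl) (simp add: monomial_avg_index sum_distrib_right sum_divide_distrib)
  also have "\<dots> = (\<Sum>x<n. \<Sum>j\<in>J. \<Sum>y<n. twist (u j) (p j) X x y * v $ y * cnj (w $ x) / of_nat (card J))"
    by (intro sum.cong refl sum.swap)
  also have "\<dots> = (\<Sum>j\<in>J. \<Sum>x<n. \<Sum>y<n. twist (u j) (p j) X x y * v $ y * cnj (w $ x) / of_nat (card J))"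
    by (rule sum.swap)
  also have "\<dots> = (\<Sum>j\<in>J. (\<Sum>x<n. \<Sum>y<n. twist (u j) (p j) X x y * v $ y * cnj (w $ x))) / of_nat (card J)"
    by (simp only: sum_divide_distrib)
  also have "\<dots> = (\<Sum>j\<in>J. (X *\<^sub>v pull_vec n (u j) (p j) v) \<bullet>c pull_vec n (u j) (p j) w) / of_nat (card J)"
    by (intro arg_cong2[of _ _ _ _ "(/)"] refl sum.cong twist_form[OF p X v w])
  finally show ?thesis .
qed

text \<open>Conjugation by a unitary is multiplicative: \<open>W* W = 1\<close> is inserted between
  the factors as \<open>cnj (u z) * u z = 1\<close>. It makes the fixed matrices closed under
  products.\<close>

lemma twist_mult:
  assumes p: "bij_betw p {..<n} {..<n}" and u: "\<And>x. x < n \<Longrightarrow> cmod (u x) = 1"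
    and A: "A \<in> carrier_mat n n" and C: "C \<in> carrier_mat n n" and xy: "x < n" "y < n"
  shows "twist u p (A * C) x y = (\<Sum>z<n. twist u p A x z * twist u p C z y)"
proof -
  have px: "p x < n" "p y < n" using p xy bij_betwE by blast+
  have uu: "cnj (u z) * u z = 1" if "z < n" for z
    using u[OF that] complex_norm_square[of "u z"] by (simp add: mult.commute)
  have "twist u p (A * C) x y = u x * cnj (u y) * (\<Sum>z<n. A $$ (p x, z) * C $$ (z, p y))"
    using A C px by (simp add: twist_def scalar_prod_def atLeast0LessThan)
  also have "(\<Sum>z<n. A $$ (p x, z) * C $$ (z, p y)) = (\<Sum>z<n. A $$ (p x, p z) * C $$ (p z, p y))"
    by (rule sum.reindex_bij_betw[OF p, symmetric])
  also have "\<dots> = (\<Sum>z<n. (cnj (u z) * u z) * (A $$ (p x, p z) * C $$ (p z, p y)))"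
    by (intro sum.cong refl) (simp add: uu)
  finally show ?thesis by (simp add: twist_def sum_distrib_left ac_simps)
qed

text \<open>The algebra \<open>B\<close> is the commutant of finitely many unitary monomial matrices, and their
  averaging map is the conditional expectation onto \<open>B\<close>.\<close>

locale monomial_averaging =
  fixes n :: nat and J :: "'j set" and u :: "'j \<Rightarrow> nat \<Rightarrow> complex" and p :: "'j \<Rightarrow> nat \<Rightarrow> nat"
    and B :: "complex mat set" and j0 :: 'j
  assumes finite_J: "finite J" and j0: "j0 \<in> J"
    and u_j0: "\<And>x. x < n \<Longrightarrow> u j0 x = 1" and p_j0: "\<And>x. x < n \<Longrightarrow> p j0 x = x"
    and bij: "\<And>j. j \<in> J \<Longrightarrow> bij_betw (p j) {..<n} {..<n}"
    and cmod_u: "\<And>j x. j \<in> J \<Longrightarrow> x < n \<Longrightarrow> cmod (u j x) = 1"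
    and B_carrier: "B \<subseteq> carrier_mat n n"
    and B_fixed: "\<And>A j x y. A \<in> B \<Longrightarrow> j \<in> J \<Longrightarrow> x < n \<Longrightarrow> y < n \<Longrightarrow>
      twist (u j) (p j) A x y = A $$ (x, y)"
    and avg_in_B: "\<And>X. X \<in> carrier_mat n n \<Longrightarrow> monomial_avg n J u p X \<in> B"
    and separated: "\<And>D. D \<in> B \<Longrightarrow>
      (\<And>e. e \<in> B \<Longrightarrow> mat_adjoint e = e \<Longrightarrow> e * e = e \<Longrightarrow> tau (e * D) = 0) \<Longrightarrow> D = 0\<^sub>m n n"
begin

abbreviation "avg \<equiv> monomial_avg n J u p"

lemma card_J: "0 < card J"
  using finite_J j0 card_gt_0_iff by blast

text \<open>A matrix fixed by every conjugation equals its own average, and averages lie in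
  \<open>B\<close>. Being a fixed-point set, \<open>B\<close> inherits products, differences and the
  unit without a concrete description.\<close>

lemma in_B_iff:
  "A \<in> B \<longleftrightarrow> A \<in> carrier_mat n n \<and>
    (\<forall>j\<in>J. \<forall>x<n. \<forall>y<n. twist (u j) (p j) A x y = A $$ (x, y))"
proof (intro iffI conjI)
  assume "A \<in> carrier_mat n n \<and> (\<forall>j\<in>J. \<forall>x<n. \<forall>y<n. twist (u j) (p j) A x y = A $$ (x, y))"
  then have A: "A \<in> carrier_mat n n"
    and fixed: "\<And>j x y. j \<in> J \<Longrightarrow> x < n \<Longrightarrow> y < n \<Longrightarrow> twist (u j) (p j) A x y = A $$ (x, y)"
    by blast+
  have "avg A = A"
    using A card_J by (intro eq_matI) (simp_all add: monomial_avg_def fixed)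
  then show "A \<in> B" using avg_in_B[OF A] by simp
qed (use B_carrier B_fixed in blast)+

lemma avg_fix: "A \<in> B \<Longrightarrow> avg A = A"
  using B_carrier card_J by (intro eq_matI) (auto simp add: monomial_avg_def B_fixed)

lemma mult_in_B: "A \<in> B \<Longrightarrow> C \<in> B \<Longrightarrow> A * C \<in> B"
proof -
  assume AC: "A \<in> B" "C \<in> B"
  then have A: "A \<in> carrier_mat n n" and C: "C \<in> carrier_mat n n" using B_carrier by blast+
  have "twist (u j) (p j) (A * C) x y = (A * C) $$ (x, y)" if "j \<in> J" "x < n" "y < n" for j x y
  proof -
    have "twist (u j) (p j) (A * C) x y
        = (\<Sum>z<n. twist (u j) (p j) A x z * twist (u j) (p j) C z y)"
      by (rule twist_mult[OF bij[OF that(1)] _ A C that(2,3)]) (rule cmod_u[OF that(1)])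
    then show ?thesis
      using AC A C that by (simp add: B_fixed scalar_prod_def atLeast0LessThan)
  qed
  then show ?thesis using A C by (simp add: in_B_iff)
qed

lemma diff_in_B:
  assumes "A \<in> B" "C \<in> B"
  shows "A - C \<in> B"
proof -
  have A: "A \<in> carrier_mat n n" and C: "C \<in> carrier_mat n n" using assms B_carrier by blast+
  have "twist (u j) (p j) (A - C) x y = (A - C) $$ (x, y)" if j: "j \<in> J" and xy: "x < n" "y < n" for j x y
  proof -
    have "p j x < n" "p j y < n" using bij[OF j] xy bij_betwE by blast+
    then have "twist (u j) (p j) (A - C) x y = twist (u j) (p j) A x y - twist (u j) (p j) C x y"
      using A C by (simp add: twist_def algebra_simps)
    then show ?thesis using assms j xy A C by (simp add: B_fixed)
  qed
  then show ?thesis using minus_carrier_mat[OF C] by (simp add: in_B_iff)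
qed

lemma one_in_B: "1\<^sub>m n \<in> B"
proof -
  have "twist (u j) (p j) (1\<^sub>m n) x y = 1\<^sub>m n $$ (x, y)" if j: "j \<in> J" and xy: "x < n" "y < n" for j x y
  proof -
    have "p j x < n" "p j y < n" using bij[OF j] xy bij_betwE by blast+
    moreover have "p j x = p j y \<longleftrightarrow> x = y"
      using bij[OF j] xy by (auto simp: bij_betw_def inj_on_def)
    moreover have "u j x * cnj (u j x) = 1"
      using complex_norm_square[of "u j x"] cmod_u[OF j xy(1)] by simp
    ultimately show ?thesis using xy by (auto simp add: twist_def)
  qed
  then show ?thesis by (simp add: in_B_iff)
qed

text \<open>Pairing \<open>avg X v\<close> with itself gives an average of forms of \<open>X\<close>
  at vectors of unchanged norm, each at most \<open>op_norm X * vec_norm2 v * vec_norm2 w\<close>;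
  one factor \<open>vec_norm2 w\<close> then cancels.\<close>

lemma op_norm_avg_le:
  assumes X: "X \<in> carrier_mat n n"
  shows "op_norm (avg X) \<le> op_norm X"
proof (rule op_norm_le)
  fix v :: "complex vec" assume "v \<in> carrier_vec (dim_col (avg X))"
  then have v: "v \<in> carrier_vec n" by (simp add: monomial_avg_def)
  define w where "w = avg X *\<^sub>v v"
  have w: "w \<in> carrier_vec n"
    unfolding w_def by (rule mult_mat_vec_carrier[OF monomial_avg_carrier v])
  have term_le: "cmod ((X *\<^sub>v pull_vec n (u j) (p j) v) \<bullet>c pull_vec n (u j) (p j) w)
      \<le> op_norm X * vec_norm2 v * vec_norm2 w" if j: "j \<in> J" for j
  proof -
    let ?v = "pull_vec n (u j) (p j) v" and ?w = "pull_vec n (u j) (p j) w"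
    have "dim_vec (X *\<^sub>v ?v) = dim_vec ?w"
      using X by (simp add: pull_vec_def)
    then have "cmod ((X *\<^sub>v ?v) \<bullet>c ?w) \<le> vec_norm2 (X *\<^sub>v ?v) * vec_norm2 ?w"
      by (rule cmod_cscalar_prod_le)
    also have "\<dots> \<le> (op_norm X * vec_norm2 ?v) * vec_norm2 ?w"
      using X by (intro mult_right_mono vec_norm2_mult_mat_le) simp_all
    finally show ?thesis
      by (simp only: vec_norm2_pull_vec[OF bij[OF j] cmod_u[OF j] v] vec_norm2_pull_vec[OF bij[OF j] cmod_u[OF j] w])
  qed
  have "complex_of_real ((vec_norm2 w)\<^sup>2) = (avg X *\<^sub>v v) \<bullet>c w"
    unfolding w_def[symmetric] by (rule cscalar_prod_self[symmetric])
  also have "\<dots> = (\<Sum>j\<in>J. (X *\<^sub>v pull_vec n (u j) (p j) v) \<bullet>c pull_vec n (u j) (p j) w) / of_nat (card J)"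
    by (rule monomial_avg_form[OF bij X v w])
  finally have "(vec_norm2 w)\<^sup>2
      = cmod ((\<Sum>j\<in>J. (X *\<^sub>v pull_vec n (u j) (p j) v) \<bullet>c pull_vec n (u j) (p j) w) / of_nat (card J))"
    by (metis abs_of_nonneg norm_of_real zero_le_power2)
  also have "\<dots> \<le> (\<Sum>j\<in>J. op_norm X * vec_norm2 v * vec_norm2 w) / card J"
    unfolding norm_divide norm_of_nat
    by (intro divide_right_mono order_trans[OF norm_sum] sum_mono term_le) simp_all
  also have "\<dots> = op_norm X * vec_norm2 v * vec_norm2 w" using card_J by simp
  finally have "vec_norm2 w * vec_norm2 w \<le> op_norm X * vec_norm2 v * vec_norm2 w"
    by (simp only: power2_eq_square)
  then show "vec_norm2 (avg X *\<^sub>v v) \<le> op_norm X * vec_norm2 v"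
    unfolding w_def[symmetric]
    by (metis mult_right_le_imp_le op_norm_nonneg order_le_less vec_norm2_nonneg mult_nonneg_nonneg)
qed simp

text \<open>On the diagonal the phases cancel, and a permutation only reorders the diagonal
  entries.\<close>

lemma tau_avg:
  assumes X: "X \<in> carrier_mat n n"
  shows "tau (avg X) = tau X"
proof -
  have d: "dim_row (avg X) = n" by (simp add: monomial_avg_def)
  have "(\<Sum>x<n. avg X $$ (x, x)) = (\<Sum>x<n. \<Sum>j\<in>J. X $$ (p j x, p j x) / of_nat (card J))"
  proof (intro sum.cong refl)
    fix x assume x: "x \<in> {..<n}"
    have "u j x * cnj (u j x) = 1" if "j \<in> J" for j
      using complex_norm_square[of "u j x"] cmod_u[OF that, of x] x by simp
    then show "avg X $$ (x, x) = (\<Sum>j\<in>J. X $$ (p j x, p j x) / of_nat (card J))"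
      using x by (simp add: monomial_avg_index twist_def sum_divide_distrib)
  qed
  also have "\<dots> = (\<Sum>j\<in>J. \<Sum>x<n. X $$ (p j x, p j x) / of_nat (card J))"
    by (rule sum.swap)
  also have "\<dots> = (\<Sum>j\<in>J. \<Sum>x<n. X $$ (x, x) / of_nat (card J))"
    by (intro sum.cong refl sum.reindex_bij_betw[OF bij])
  also have "\<dots> = (\<Sum>x<n. X $$ (x, x))"
    using card_J by (simp flip: sum_divide_distrib)
  finally show ?thesis using X d by (simp add: tau_def)
qed

lemma is_cond_exp_avg: "is_cond_exp n B (restrict avg (carrier_mat n n))"
proof -
  have pb: "p j x < n" if "j \<in> J" "x < n" for j x using bij[OF that(1)] that(2) bij_betwE by blast
  have add: "avg (X + Y) = avg X + avg Y" if "X \<in> carrier_mat n n" "Y \<in> carrier_mat n n" for X Y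
  proof (rule eq_matI)
    fix x y assume "x < dim_row (avg X + avg Y)" "y < dim_col (avg X + avg Y)"
    then have xy: "x < n" "y < n" by (simp_all add: monomial_avg_def)
    have "twist (u j) (p j) (X + Y) x y = twist (u j) (p j) X x y + twist (u j) (p j) Y x y" if "j \<in> J" for j
      using pb[OF that] xy \<open>X \<in> _\<close> \<open>Y \<in> _\<close> by (simp add: twist_def algebra_simps)
    then show "avg (X + Y) $$ (x, y) = (avg X + avg Y) $$ (x, y)"
      using xy by (simp add: monomial_avg_def sum.distrib add_divide_distrib)
  qed (simp_all add: monomial_avg_def)
  have smult: "avg (c \<cdot>\<^sub>m X) = c \<cdot>\<^sub>m avg X" if "X \<in> carrier_mat n n" for c X
  proof (rule eq_matI)
    fix x y assume "x < dim_row (c \<cdot>\<^sub>m avg X)" "y < dim_col (c \<cdot>\<^sub>m avg X)"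
    then have xy: "x < n" "y < n" by (simp_all add: monomial_avg_def)
    have "twist (u j) (p j) (c \<cdot>\<^sub>m X) x y = c * twist (u j) (p j) X x y" if "j \<in> J" for j
      using pb[OF that] xy \<open>X \<in> _\<close> by (simp add: twist_def algebra_simps)
    then show "avg (c \<cdot>\<^sub>m X) $$ (x, y) = (c \<cdot>\<^sub>m avg X) $$ (x, y)"
      using xy by (simp add: monomial_avg_def sum_distrib_left)
  qed (simp_all add: monomial_avg_def)
  have "\<And>X. X \<in> B \<Longrightarrow> X \<in> carrier_mat n n" using B_carrier by blast
  then show ?thesis
    unfolding is_cond_exp_def
    by (auto simp: add smult avg_in_B avg_fix op_norm_avg_le tau_avg add_carrier_mat smult_carrier_mat)
qed

section \<open>Uniqueness of the conditional expectation\<close>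

lemma is_cond_exp_tau_mult:
  assumes P: "is_cond_exp n B P" and e: "e \<in> B" "mat_adjoint e = e" "e * e = e"
    and X: "X \<in> carrier_mat n n"
  shows "tau (e * P X) = tau (e * X)"
proof -
  have eC: "e \<in> carrier_mat n n" using e B_carrier by blast
  have "P (e * X) = e * P X"
    by (rule cond_exp_mult_projection[OF P B_carrier eC e(2,3) _ _ X])
      (intro mult_in_B diff_in_B one_in_B e(1); assumption)+
  then show ?thesis using is_cond_exp_tau[OF P, of "e * X"] eC X by simp
qed

lemma tau_mult_diff:
  assumes "e \<in> carrier_mat n n" "A \<in> carrier_mat n n" "C \<in> carrier_mat n n"
  shows "tau (e * (A - C)) = tau (e * A) - tau (e * C)"
  unfolding mult_minus_distrib_mat[OF assms]
  using assms by (simp add: tau_def sum_subtractf diff_divide_distrib)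

lemma is_cond_exp_unique:
  assumes P: "is_cond_exp n B P" and Q: "is_cond_exp n B Q"
  shows "P = Q"
proof
  fix X
  show "P X = Q X"
  proof (cases "X \<in> carrier_mat n n")
    case X: True
    have PX: "P X \<in> B" and QX: "Q X \<in> B" using is_cond_exp_mem[OF P X] is_cond_exp_mem[OF Q X] .
    then have C: "P X \<in> carrier_mat n n" "Q X \<in> carrier_mat n n" using B_carrier by blast+
    have "P X - Q X = 0\<^sub>m n n"
    proof (rule separated[OF diff_in_B[OF PX QX]])
      fix e assume e: "e \<in> B" "mat_adjoint e = e" "e * e = e"
      then have eC: "e \<in> carrier_mat n n" using B_carrier by blast
      show "tau (e * (P X - Q X)) = 0"
        unfolding tau_mult_diff[OF eC C] is_cond_exp_tau_mult[OF P e X] is_cond_exp_tau_mult[OF Q e X]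
        by simp
    qed
    then have "P X $$ (x, y) = Q X $$ (x, y)" if "x < n" "y < n" for x y
      using C that index_minus_mat(1)[of x "Q X" y "P X"] by simp
    then show ?thesis using C by (intro eq_matI) simp_all
  next
    case False
    then show ?thesis using is_cond_exp_undefined[OF P] is_cond_exp_undefined[OF Q] by simp
  qed
qed

text \<open>Here the definite description disappears; the norm estimates below concern the explicit
  average.\<close>

lemma cond_exp_eq_avg:
  assumes "X \<in> carrier_mat n n"
  shows "cond_exp n B X = avg X"
proof -
  have "cond_exp n B = restrict avg (carrier_mat n n)"
    unfolding cond_exp_def
    by (rule the_equality[where a = "restrict avg (carrier_mat n n)"])
      (use is_cond_exp_avg is_cond_exp_unique in blast)+
  then show ?thesis using assms by simp
qed

text \<open>In the form of \<open>card J\<close> times the average every term is nonnegative, and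
  the term \<open>j0\<close> is the form of \<open>X\<close> itself. Positivity is stated through
  the form, so \<open>X* X\<close> qualifies directly, with no detour through
  \<open>psd\<close>.\<close>

lemma positive_form_le:
  assumes X: "X \<in> carrier_mat n n" and pos: "\<And>v. v \<in> carrier_vec n \<Longrightarrow> 0 \<le> Re ((X *\<^sub>v v) \<bullet>c v)"
    and v: "v \<in> carrier_vec n"
  shows "Re ((X *\<^sub>v v) \<bullet>c v) \<le> card J * op_norm (avg X) * (vec_norm2 v)\<^sup>2"
proof -
  let ?f = "\<lambda>j. Re ((X *\<^sub>v pull_vec n (u j) (p j) v) \<bullet>c pull_vec n (u j) (p j) v)"
  have "pull_vec n (u j0) (p j0) v = v"
  proof (rule eq_vecI)
    fix x assume "x < dim_vec v"
    then have x: "x < n" using v by simp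
    show "pull_vec n (u j0) (p j0) v $ x = v $ x"
      using pull_vec_index[OF bij[OF j0] x, of "u j0" v] x by (simp add: u_j0 p_j0)
  qed (use v in \<open>simp add: pull_vec_def\<close>)
  then have "Re ((X *\<^sub>v v) \<bullet>c v) = ?f j0" by simp
  also have "\<dots> \<le> (\<Sum>j\<in>J. ?f j)"
    by (rule member_le_sum[OF j0 _ finite_J]) (rule pos, simp)
  also have "\<dots> = card J * Re ((avg X *\<^sub>v v) \<bullet>c v)"
    using card_J by (simp add: monomial_avg_form[OF bij X v v])
  also have "\<dots> \<le> card J * (op_norm (avg X) * (vec_norm2 v)\<^sup>2)"
  proof (rule mult_left_mono)
    have d: "dim_vec (avg X *\<^sub>v v) = dim_vec v" using v by (simp add: monomial_avg_def)
    have "Re ((avg X *\<^sub>v v) \<bullet>c v) \<le> vec_norm2 (avg X *\<^sub>v v) * vec_norm2 v"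
      using cmod_cscalar_prod_le[OF d] complex_Re_le_cmod order_trans by blast
    also have "\<dots> \<le> op_norm (avg X) * vec_norm2 v * vec_norm2 v"
      using v by (intro mult_right_mono vec_norm2_mult_mat_le) (simp_all add: monomial_avg_def)
    finally show "Re ((avg X *\<^sub>v v) \<bullet>c v) \<le> op_norm (avg X) * (vec_norm2 v)\<^sup>2"
      by (simp only: power2_eq_square mult.assoc)
  qed simp
  finally show ?thesis by (simp only: mult.assoc)
qed

lemma op_norm_le_cond_exp:
  assumes X: "X \<in> carrier_mat n n" "psd X"
  shows "op_norm X \<le> card J * op_norm (cond_exp n B X)"
  unfolding cond_exp_eq_avg[OF X(1)]
  by (rule op_norm_psd_le[OF X]) (use X positive_form_le[OF X(1)] in \<open>simp_all add: psd_def\<close>)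

text \<open>The form of \<open>X* X\<close> at \<open>v\<close> is the squared norm of
  \<open>X v\<close>, so the form inequality bounds \<open>op_norm X\<close> at once, and the square
  root of the constant appears.\<close>

lemma op_norm_le_fr_norm:
  assumes X: "X \<in> carrier_mat n n"
  shows "op_norm X \<le> sqrt (card J) * fr_norm n B X"
proof -
  define Y where "Y = mat_adjoint X * X"
  have aX: "mat_adjoint X \<in> carrier_mat n n" using X by simp
  have Y: "Y \<in> carrier_mat n n" unfolding Y_def by (rule mult_carrier_mat[OF aX X])
  have form: "Re ((Y *\<^sub>v v) \<bullet>c v) = (vec_norm2 (X *\<^sub>v v))\<^sup>2" if v: "v \<in> carrier_vec n" for v
  proof -
    have Xv: "X *\<^sub>v v \<in> carrier_vec n" using X v by simp
    have Yv: "Y *\<^sub>v v \<in> carrier_vec n" using Y v by simp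
    have "(X *\<^sub>v v) \<bullet>c (X *\<^sub>v v) = v \<bullet>c (Y *\<^sub>v v)"
      unfolding cscalar_prod_mat_adjoint[OF X v Xv] Y_def assoc_mult_mat_vec[OF aX X v] ..
    moreover have "Re ((Y *\<^sub>v v) \<bullet>c v) = Re (v \<bullet>c (Y *\<^sub>v v))"
      using cscalar_prod_commute[of v "Y *\<^sub>v v"] v Yv Y by simp
    ultimately show ?thesis by (simp only: vec_norm2_sq)
  qed
  have "op_norm X \<le> sqrt (card J * op_norm (avg Y))"
  proof (rule op_norm_le)
    fix v :: "complex vec" assume "v \<in> carrier_vec (dim_col X)"
    then have v: "v \<in> carrier_vec n" using X by simp
    have "(vec_norm2 (X *\<^sub>v v))\<^sup>2 \<le> card J * op_norm (avg Y) * (vec_norm2 v)\<^sup>2"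
      unfolding form[OF v, symmetric] by (rule positive_form_le[OF Y _ v]) (simp add: form)
    also have "\<dots> = (sqrt (card J * op_norm (avg Y)) * vec_norm2 v)\<^sup>2"
      by (simp add: power_mult_distrib)
    finally show "vec_norm2 (X *\<^sub>v v) \<le> sqrt (card J * op_norm (avg Y)) * vec_norm2 v"
      by (rule power2_le_imp_le) simp
  qed simp
  then show ?thesis
    by (simp add: fr_norm_def cond_exp_eq_avg[OF Y] real_sqrt_mult flip: Y_def)
qed

end

section \<open>Block diagonal matrices with repeated blocks\<close>

text \<open>Orthogonality of the characters of the cyclic group of order \<open>r\<close>: a
  geometric sum over an \<open>r\<close>-th root of unity. It separates diagonal blocks with
  different numbers.\<close>

lemma sum_roots_of_unity:
  fixes b b' r :: nat
  assumes "b < r" "b' < r"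
  shows "(\<Sum>s<r. cis (2 * pi * s * b / r) * cnj (cis (2 * pi * s * b' / r)))
    = (if b = b' then of_nat r else 0)"
proof (cases "b = b'")
  case True
  have "cis t * cnj (cis t) = 1" for t by (simp add: cis_cnj cis_mult)
  then show ?thesis using True by simp
next
  case False
  define z where "z = cis (2 * pi * (real b - real b') / r)"
  have r: "0 < real r" using assms by simp
  have pow: "cis (2 * pi * s * b / r) * cnj (cis (2 * pi * s * b' / r)) = z ^ s" for s
    by (simp add: z_def DeMoivre cis_cnj cis_mult diff_divide_distrib right_diff_distrib mult.assoc mult.left_commute)
  \<comment> \<open>A value of 1 would make \<open>(b - b') / r\<close> an integer, while
    \<open>b - b'\<close> is nonzero and smaller than \<open>r\<close> in absolute value.\<close>
  have "z \<noteq> 1"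
  proof
    assume "z = 1"
    then have "cos (2 * pi * (real b - real b') / r) = 1"
      unfolding z_def by (metis cis.simps(1) one_complex.simps(1))
    then obtain k :: int where "2 * pi * (real b - real b') / r = of_int k * 2 * pi"
      using cos_one_2pi_int by blast
    then have "(2 * pi) * ((real b - real b') / r) = (2 * pi) * of_int k"
      by (simp add: ac_simps)
    then have "(real b - real b') / r = of_int k"
      by (rule mult_left_cancel[THEN iffD1, rotated]) simp
    then have "real_of_int (int b - int b') = real_of_int (k * int r)"
      using r by (simp add: field_simps)
    then have k: "int b - int b' = k * int r" by (simp only: of_int_eq_iff)
    then have "int r dvd int b - int b'" by simp
    moreover have "\<bar>int b - int b'\<bar> < int r" using assms by linarith
    moreover have "int b - int b' \<noteq> 0" using False by simp
    ultimately show False using dvd_imp_le_int[of "int b - int b'" "int r"] by simp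
  qed
  moreover have "z ^ r = 1"
  proof -
    have "z ^ r = cis (2 * pi * real_of_int (int b - int b'))"
      using r by (simp add: z_def DeMoivre)
    also have "\<dots> = 1" by (rule cis_multiple_2pi) simp
    finally show ?thesis .
  qed
  ultimately have "(\<Sum>s<r. z ^ s) = 0" by (simp add: geometric_sum)
  then show ?thesis using False by (simp add: pow)
qed

text \<open>The \<open>l\<close> terms run through whole periods, so the starting point is
  immaterial. This is where the least common multiple enters: one \<open>l\<close> has to serve
  every multiplicity.\<close>

lemma sum_mod_shift:
  fixes g :: "nat \<Rightarrow> 'a::ab_group_add"
  assumes "m dvd l"
  shows "(\<Sum>t<l. g ((c + t) mod m)) = (\<Sum>t<l. g (t mod m))"
proof (induction c)
  case (Suc c)
  \<comment> \<open>The sum of \<open>l + 1\<close> terms is split off at its first and at its last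
    term; these agree modulo \<open>m\<close>.\<close>
  have "(\<Sum>t<l. g ((c + Suc t) mod m)) + g (c mod m) = (\<Sum>t<Suc l. g ((c + t) mod m))"
    by (subst sum.lessThan_Suc_shift) simp
  also have "\<dots> = (\<Sum>t<l. g ((c + t) mod m)) + g (c mod m)"
    using assms by (simp add: mod_add_right_eq[of c l, symmetric])
  finally show ?case using Suc by simp
qed simp

lemma mod_add_right_cancel_less:
  fixes c c' k t :: nat
  assumes "c < k" "c' < k"
  shows "(c + t) mod k = (c' + t) mod k \<longleftrightarrow> c = c'"
proof -
  have "a = b" if "(a + t) mod k = (b + t) mod k" "a < k" "b \<le> a" for a b
  proof -
    have "k dvd a - b" using that mod_eq_dvd_iff_nat[of "b + t" "a + t" k] by simp
    moreover have "a - b < k" using that by simp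
    ultimately show ?thesis using that by (auto dest: dvd_imp_le)
  qed
  from this[of c c'] this[of c' c] assms show ?thesis by (cases "c' \<le> c") auto
qed

text \<open>Polarisation: a vector supported at one index gives the diagonal, vectors supported at
  two indices give the rest. Complex scalars make this work for any \<open>K\<close>, Hermitian or
  not.\<close>

lemma hermitian_form_zero_imp_zero:
  fixes K :: "nat \<Rightarrow> nat \<Rightarrow> complex"
  assumes form: "\<And>w. (\<Sum>a<d. \<Sum>b<d. w a * cnj (w b) * K b a) = 0"
    and ab: "a0 < d" "b0 < d"
  shows "K a0 b0 = 0"
proof -
  have restrict: "(\<Sum>a\<in>T. \<Sum>b\<in>T. w a * cnj (w b) * K b a) = 0"
    if T: "T \<subseteq> {..<d}" and w: "\<And>a. a \<notin> T \<Longrightarrow> w a = 0" for T and w :: "nat \<Rightarrow> complex"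
  proof -
    have "(\<Sum>a<d. \<Sum>b<d. w a * cnj (w b) * K b a) = (\<Sum>a\<in>T. \<Sum>b<d. w a * cnj (w b) * K b a)"
      by (rule sum.mono_neutral_right) (use T w in auto)
    also have "\<dots> = (\<Sum>a\<in>T. \<Sum>b\<in>T. w a * cnj (w b) * K b a)"
      by (intro sum.cong refl sum.mono_neutral_right) (use T w in auto)
    finally show ?thesis by (simp only: form)
  qed
  have diag: "K a a = 0" if "a < d" for a
    using restrict[of "{a}" "\<lambda>x. if x = a then 1 else 0"] that by simp
  show ?thesis
  proof (cases "a0 = b0")
    case False
    have "z * K a0 b0 + cnj z * K b0 a0 = 0" for z
      using restrict[of "{a0, b0}" "\<lambda>x. if x = a0 then 1 else if x = b0 then z else 0"] ab False
      by (simp add: diag)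
    \<comment> \<open>\<open>z = 1\<close> kills the symmetric part of the pair,
      \<open>z = \<i>\<close> the antisymmetric part.\<close>
    from this[of 1] this[of \<i>] have "K a0 b0 + K b0 a0 = 0" "K a0 b0 = K b0 a0"
      by (simp_all flip: right_diff_distrib)
    then show ?thesis by simp
  qed (use ab diag in simp)
qed

text \<open>\<open>P i c a\<close> is the matrix position of the basis vector \<open>a\<close> in the copy \<open>c\<close> of the
  summand \<open>i\<close>, and \<open>blk i c\<close> numbers the diagonal blocks.\<close>

locale block_labelling =
  fixes n r l L :: nat and m d :: "nat \<Rightarrow> nat" and P :: "nat \<Rightarrow> nat \<Rightarrow> nat \<Rightarrow> nat"
    and blk :: "nat \<Rightarrow> nat \<Rightarrow> nat"
  assumes bij_P: "bij_betw (\<lambda>(i, c, a). P i c a) (SIGMA i:{..<L}. {..<m i} \<times> {..<d i}) {..<n}"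
    and blk_less: "i < L \<Longrightarrow> c < m i \<Longrightarrow> blk i c < r"
    and blk_inj: "i < L \<Longrightarrow> c < m i \<Longrightarrow> i' < L \<Longrightarrow> c' < m i' \<Longrightarrow> blk i c = blk i' c' \<Longrightarrow> i = i' \<and> c = c'"
    and dvd_l: "i < L \<Longrightarrow> m i dvd l"
    and r_pos: "0 < r" and l_pos: "0 < l"
begin

abbreviation "S \<equiv> SIGMA i:{..<L}. {..<m i} \<times> {..<d i}"

definition lab :: "nat \<Rightarrow> nat \<times> nat \<times> nat" where
  "lab = inv_into S (\<lambda>(i, c, a). P i c a)"

text \<open>The coefficients \<open>\<alpha>\<close> carry no copy index \<open>c\<close>, which
  forces the copies of a summand to coincide. Values of \<open>\<alpha>\<close> outside the index
  ranges are unconstrained.\<close>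

definition has_blocks :: "complex mat \<Rightarrow> (nat \<Rightarrow> nat \<Rightarrow> nat \<Rightarrow> complex) \<Rightarrow> bool" where
  "has_blocks A \<alpha> \<longleftrightarrow> A \<in> carrier_mat n n \<and>
    (\<forall>i c a i' c' b. i < L \<longrightarrow> c < m i \<longrightarrow> a < d i \<longrightarrow> i' < L \<longrightarrow> c' < m i' \<longrightarrow> b < d i' \<longrightarrow>
      A $$ (P i c a, P i' c' b) = (if i = i' \<and> c = c' then \<alpha> i a b else 0))"

definition block_mat :: "(nat \<Rightarrow> nat \<Rightarrow> nat \<Rightarrow> complex) \<Rightarrow> complex mat" where
  "block_mat \<alpha> = mat n n (\<lambda>(x, y). case (lab x, lab y) of
    ((i, c, a), (i', c', b)) \<Rightarrow> if i = i' \<and> c = c' then \<alpha> i a b else 0)"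

text \<open>\<open>phase (s, t)\<close> is the diagonal of \<open>D^s\<close> and, below,
  \<open>shift (s, t)\<close> the permutation of \<open>S^t\<close>; together they encode the
  monomial matrix \<open>D^s S^t\<close>. Each reads only its half of the index.\<close>

definition phase :: "nat \<times> nat \<Rightarrow> nat \<Rightarrow> complex" where
  "phase = (\<lambda>(s, t) x. case lab x of (i, c, a) \<Rightarrow> cis (2 * pi * s * blk i c / r))"

definition shift :: "nat \<times> nat \<Rightarrow> nat \<Rightarrow> nat" where
  "shift = (\<lambda>(s, t) x. case lab x of (i, c, a) \<Rightarrow> P i ((c + t) mod m i) a)"

lemma P_less: "i < L \<Longrightarrow> c < m i \<Longrightarrow> a < d i \<Longrightarrow> P i c a < n"
  using bij_betwE[OF bij_P] by force

lemma lab_P: "i < L \<Longrightarrow> c < m i \<Longrightarrow> a < d i \<Longrightarrow> lab (P i c a) = (i, c, a)"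
  using bij_betw_inv_into_left[OF bij_P, of "(i, c, a)"] by (simp add: lab_def)

lemma P_cases:
  assumes "x < n"
  obtains i c a where "x = P i c a" "i < L" "c < m i" "a < d i"
proof -
  have "x \<in> (\<lambda>(i, c, a). P i c a) ` S" using bij_P assms by (simp add: bij_betw_def)
  then show ?thesis using that by auto
qed

lemma sum_P: "(\<Sum>x<n. g x) = (\<Sum>i<L. \<Sum>c<m i. \<Sum>a<d i. g (P i c a))"
proof -
  have "(\<Sum>x<n. g x) = (\<Sum>z\<in>S. g ((\<lambda>(i, c, a). P i c a) z))"
    by (rule sum.reindex_bij_betw[OF bij_P, symmetric])
  also have "\<dots> = (\<Sum>i<L. \<Sum>z\<in>{..<m i} \<times> {..<d i}. g ((\<lambda>(i, c, a). P i c a) (i, z)))"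
    by (subst sum.Sigma) (auto simp: case_prod_unfold)
  also have "\<dots> = (\<Sum>i<L. \<Sum>c<m i. \<Sum>a<d i. g (P i c a))"
    by (intro sum.cong refl) (simp add: sum.cartesian_product case_prod_unfold)
  finally show ?thesis .
qed

lemma has_blocks_carrier: "has_blocks A \<alpha> \<Longrightarrow> A \<in> carrier_mat n n"
  by (simp add: has_blocks_def)

lemma has_blocksD:
  assumes "has_blocks A \<alpha>" "i < L" "c < m i" "a < d i" "i' < L" "c' < m i'" "b < d i'"
  shows "A $$ (P i c a, P i' c' b) = (if i = i' \<and> c = c' then \<alpha> i a b else 0)"
  using assms unfolding has_blocks_def by blast

lemma has_blocksI:
  assumes "A \<in> carrier_mat n n"
    and "\<And>i c a i' c' b. i < L \<Longrightarrow> c < m i \<Longrightarrow> a < d i \<Longrightarrow> i' < L \<Longrightarrow> c' < m i' \<Longrightarrow> b < d i' \<Longrightarrow>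
      A $$ (P i c a, P i' c' b) = (if i = i' \<and> c = c' then \<alpha> i a b else 0)"
  shows "has_blocks A \<alpha>"
  using assms unfolding has_blocks_def by blast

lemma has_blocks_block_mat: "has_blocks (block_mat \<alpha>) \<alpha>"
  by (rule has_blocksI) (simp_all add: block_mat_def lab_P P_less)

lemma has_blocks_eqI:
  assumes A: "has_blocks A \<alpha>" and C: "has_blocks C \<gamma>"
    and eq: "\<And>i a b. i < L \<Longrightarrow> a < d i \<Longrightarrow> b < d i \<Longrightarrow> \<alpha> i a b = \<gamma> i a b"
  shows "A = C"
proof (rule eq_matI)
  note carr = has_blocks_carrier[OF A] has_blocks_carrier[OF C]
  fix x y assume xy: "x < dim_row C" "y < dim_col C"
  have "x < n" "y < n" using xy carr by simp_all
  obtain i c a where x: "x = P i c a" "i < L" "c < m i" "a < d i" using P_cases[OF \<open>x < n\<close>] .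
  obtain i' c' b where y: "y = P i' c' b" "i' < L" "c' < m i'" "b < d i'" using P_cases[OF \<open>y < n\<close>] .
  show "A $$ (x, y) = C $$ (x, y)"
    using has_blocksD[OF A x(2-4) y(2-4)] has_blocksD[OF C x(2-4) y(2-4)] eq x y by auto
qed (use has_blocks_carrier[OF A] has_blocks_carrier[OF C] in simp_all)

lemma has_blocks_mult:
  assumes A: "has_blocks A \<alpha>" and C: "has_blocks C \<gamma>"
  shows "has_blocks (A * C) (\<lambda>i a b. \<Sum>k<d i. \<alpha> i a k * \<gamma> i k b)"
proof (rule has_blocksI)
  note carr = has_blocks_carrier[OF A] has_blocks_carrier[OF C]
  show "A * C \<in> carrier_mat n n" using carr by simp
  fix i c a i' c' b
  assume x: "i < L" "c < m i" "a < d i" and y: "i' < L" "c' < m i'" "b < d i'"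
  let ?f = "\<lambda>j e k. A $$ (P i c a, P j e k) * C $$ (P j e k, P i' c' b)"
  have "(A * C) $$ (P i c a, P i' c' b) = (\<Sum>z<n. A $$ (P i c a, z) * C $$ (z, P i' c' b))"
    using carr P_less[OF x] P_less[OF y] by (simp add: scalar_prod_def atLeast0LessThan)
  also have "\<dots> = (\<Sum>j<L. \<Sum>e<m j. \<Sum>k<d j. ?f j e k)" by (rule sum_P)
  \<comment> \<open>\<open>A\<close> vanishes off the block \<open>(i, c)\<close>, so the sums over
    summands and over copies collapse in turn.\<close>
  also have "\<dots> = (\<Sum>j\<in>{i}. \<Sum>e<m j. \<Sum>k<d j. ?f j e k)"
    by (rule sum.mono_neutral_right) (use x in \<open>auto simp: has_blocksD[OF A]\<close>)
  also have "\<dots> = (\<Sum>e<m i. \<Sum>k<d i. ?f i e k)" by simp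
  also have "\<dots> = (\<Sum>e\<in>{c}. \<Sum>k<d i. ?f i e k)"
    by (rule sum.mono_neutral_right) (use x in \<open>auto simp: has_blocksD[OF A]\<close>)
  also have "\<dots> = (\<Sum>k<d i. ?f i c k)" by simp
  also have "\<dots> = (\<Sum>k<d i. if i = i' \<and> c = c' then \<alpha> i a k * \<gamma> i k b else 0)"
    by (intro sum.cong refl) (use x y in \<open>simp add: has_blocksD[OF A] has_blocksD[OF C]\<close>)
  also have "\<dots> = (if i = i' \<and> c = c' then \<Sum>k<d i. \<alpha> i a k * \<gamma> i k b else 0)"
    by (cases "i = i' \<and> c = c'") (simp, simp only: if_False sum.neutral_const)
  finally show "(A * C) $$ (P i c a, P i' c' b)
    = (if i = i' \<and> c = c' then \<Sum>k<d i. \<alpha> i a k * \<gamma> i k b else 0)" .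
qed

lemma has_blocks_adjoint:
  assumes A: "has_blocks A \<alpha>"
  shows "has_blocks (mat_adjoint A) (\<lambda>i a b. cnj (\<alpha> i b a))"
proof (rule has_blocksI)
  note carr = has_blocks_carrier[OF A]
  show "mat_adjoint A \<in> carrier_mat n n" using carr by simp
  fix i c a i' c' b
  assume x: "i < L" "c < m i" "a < d i" and y: "i' < L" "c' < m i'" "b < d i'"
  show "mat_adjoint A $$ (P i c a, P i' c' b) = (if i = i' \<and> c = c' then cnj (\<alpha> i b a) else 0)"
    using carr P_less[OF x] P_less[OF y] x y by (auto simp: has_blocksD[OF A])
qed

lemma tau_has_blocks:
  assumes A: "has_blocks A \<alpha>"
  shows "tau A = (\<Sum>i<L. of_nat (m i) * (\<Sum>a<d i. \<alpha> i a a)) / of_nat n"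
proof -
  have "(\<Sum>x<n. A $$ (x, x)) = (\<Sum>i<L. \<Sum>c<m i. \<Sum>a<d i. A $$ (P i c a, P i c a))" by (rule sum_P)
  also have "\<dots> = (\<Sum>i<L. of_nat (m i) * (\<Sum>a<d i. \<alpha> i a a))"
    by (intro sum.cong refl) (simp add: has_blocksD[OF A])
  finally show ?thesis using has_blocks_carrier[OF A] by (simp add: tau_def)
qed

text \<open>Test projections: \<open>w w*\<close>, normalised, in every copy of the summand \<open>i\<close>.\<close>

lemma has_blocks_zeroI:
  assumes D: "has_blocks D \<delta>"
    and orth: "\<And>e. \<exists>\<alpha>. has_blocks e \<alpha> \<Longrightarrow> mat_adjoint e = e \<Longrightarrow> e * e = e \<Longrightarrow> tau (e * D) = 0"
  shows "D = 0\<^sub>m n n"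
proof -
  have form: "(\<Sum>a<d i. \<Sum>b<d i. w a * cnj (w b) * \<delta> i b a) = 0" if i: "i < L" "0 < m i" for i and w :: "nat \<Rightarrow> complex"
  proof (cases "\<forall>a<d i. w a = 0")
    case False
    define s where "s = (\<Sum>a<d i. w a * cnj (w a))"
    have s_real: "s = of_real (\<Sum>a<d i. (cmod (w a))\<^sup>2)"
      by (simp only: s_def complex_norm_square of_real_sum)
    have "(\<Sum>a<d i. (cmod (w a))\<^sup>2) \<noteq> 0"
      using False by (auto simp: sum_nonneg_eq_0_iff)
    then have s: "s \<noteq> 0" unfolding s_real of_real_eq_0_iff .
    have cnj_s: "cnj s = s" unfolding s_real complex_cnj_complex_of_real ..
    define \<alpha> where "\<alpha> = (\<lambda>j a b. if j = i then w a * cnj (w b) / s else 0)"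
    define e where "e = block_mat \<alpha>"
    have e: "has_blocks e \<alpha>" unfolding e_def by (rule has_blocks_block_mat)
    have "mat_adjoint e = e"
      by (rule has_blocks_eqI[OF has_blocks_adjoint[OF e] e]) (simp add: \<alpha>_def cnj_s)
    moreover have "e * e = e"
    proof (rule has_blocks_eqI[OF has_blocks_mult[OF e e] e])
      fix j a b
      have "(\<Sum>k<d i. w a * cnj (w k) / s * (w k * cnj (w b) / s))
          = (\<Sum>k<d i. w a * cnj (w b) / (s * s) * (w k * cnj (w k)))"
        by (intro sum.cong refl) (simp add: ac_simps)
      also have "\<dots> = w a * cnj (w b) / (s * s) * s"
        unfolding sum_distrib_left[symmetric] by (simp only: s_def[symmetric])
      finally show "(\<Sum>k<d j. \<alpha> j a k * \<alpha> j k b) = \<alpha> j a b" using s by (simp add: \<alpha>_def)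
    qed
    ultimately have 0: "tau (e * D) = 0" by (intro orth) (use e in blast)
    \<comment> \<open>\<open>tau\<close> divides by \<open>n\<close>, so a vanishing trace is
      informative only for positive \<open>n\<close>; a coordinate where \<open>w\<close> is nonzero
      supplies a position.\<close>
    have "n \<noteq> 0"
      using False P_less[OF i] by fastforce
    moreover have "tau (e * D) = (\<Sum>j<L. of_nat (m j) * (\<Sum>a<d j. \<Sum>k<d j. \<alpha> j a k * \<delta> j k a)) / of_nat n"
      by (rule tau_has_blocks[OF has_blocks_mult[OF e D]])
    ultimately have "0 = (\<Sum>j<L. of_nat (m j) * (\<Sum>a<d j. \<Sum>k<d j. \<alpha> j a k * \<delta> j k a))"
      using 0 by simp
    also have "\<dots> = (\<Sum>j\<in>{i}. of_nat (m j) * (\<Sum>a<d j. \<Sum>k<d j. \<alpha> j a k * \<delta> j k a))"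
      by (rule sum.mono_neutral_right) (use i in \<open>auto simp: \<alpha>_def\<close>)
    also have "\<dots> = of_nat (m i) * (\<Sum>a<d i. \<Sum>k<d i. w a * cnj (w k) * \<delta> i k a) / s"
      by (simp add: \<alpha>_def sum_divide_distrib sum_distrib_left)
    finally show ?thesis using i s by simp
  qed simp
  have zero: "has_blocks (0\<^sub>m n n) (\<lambda>i a b. 0)"
    by (rule has_blocksI) (simp_all add: P_less)
  \<comment> \<open>A summand without copies occupies no position, so its coefficients in
    \<open>\<delta>\<close> are arbitrary and are reset to zero.\<close>
  have "has_blocks D (\<lambda>i a b. if 0 < m i then \<delta> i a b else 0)"
    by (rule has_blocksI) (simp_all add: has_blocks_carrier[OF D] has_blocksD[OF D])
  then show ?thesis
    by (rule has_blocks_eqI[OF _ zero]) (auto intro: hermitian_form_zero_imp_zero form)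
qed

section \<open>Phases, cyclic shifts and their average\<close>

lemma phase_P: "i < L \<Longrightarrow> c < m i \<Longrightarrow> a < d i \<Longrightarrow> phase (s, t) (P i c a) = cis (2 * pi * s * blk i c / r)"
  by (simp add: phase_def lab_P)

lemma shift_P: "i < L \<Longrightarrow> c < m i \<Longrightarrow> a < d i \<Longrightarrow> shift (s, t) (P i c a) = P i ((c + t) mod m i) a"
  by (simp add: shift_def lab_P)

text \<open>Each summand's copies are rotated, which is injective; finiteness of the index set does
  the rest.\<close>

lemma bij_shift: "bij_betw (shift j) {..<n} {..<n}"
proof -
  obtain s t where j: "j = (s, t)" by (cases j)
  have inj: "inj_on (shift j) {..<n}"
  proof (rule inj_onI)
    fix x y assume "x \<in> {..<n}" "y \<in> {..<n}" and eq: "shift j x = shift j y"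
    then have "x < n" "y < n" by simp_all
    obtain i c a where x: "x = P i c a" "i < L" "c < m i" "a < d i" using P_cases[OF \<open>x < n\<close>] .
    obtain i' c' b where y: "y = P i' c' b" "i' < L" "c' < m i'" "b < d i'" using P_cases[OF \<open>y < n\<close>] .
    have ms: "(c + t) mod m i < m i" "(c' + t) mod m i' < m i'" using x y by simp_all
    have "P i ((c + t) mod m i) a = P i' ((c' + t) mod m i') b"
      using eq x y by (simp add: j shift_P)
    then have "lab (P i ((c + t) mod m i) a) = lab (P i' ((c' + t) mod m i') b)" by (rule arg_cong)
    then have "(i, (c + t) mod m i, a) = (i', (c' + t) mod m i', b)"
      unfolding lab_P[OF x(2) ms(1) x(4)] lab_P[OF y(2) ms(2) y(4)] .
    then show "x = y" using x y by (auto simp: mod_add_right_cancel_less)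
  qed
  moreover have "shift j x < n" if "x < n" for x
    using that by (cases rule: P_cases) (simp add: j shift_P P_less)
  then have "shift j ` {..<n} \<subseteq> {..<n}" by auto
  ultimately show ?thesis by (simp add: bij_betw_def endo_inj_surj)
qed

text \<open>The sum over \<open>(s, t)\<close> is a product. Its \<open>s\<close> factor is
  \<open>r\<close> on a diagonal block and zero elsewhere, because \<open>blk\<close> distinguishes
  copies as well as summands; its \<open>t\<close> factor loses the copy index \<open>c\<close> by
  periodicity, which makes the coefficients common to all copies.\<close>

lemma has_blocks_avg:
  assumes X: "X \<in> carrier_mat n n"
  shows "has_blocks (monomial_avg n ({..<r} \<times> {..<l}) phase shift X)
    (\<lambda>i a b. (\<Sum>t<l. X $$ (P i (t mod m i) a, P i (t mod m i) b)) / of_nat l)"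
proof (rule has_blocksI)
  fix i c a i' c' b
  assume x: "i < L" "c < m i" "a < d i" and y: "i' < L" "c' < m i'" "b < d i'"
  let ?X = "\<lambda>t. X $$ (P i ((c + t) mod m i) a, P i' ((c' + t) mod m i') b)"
  let ?z = "\<lambda>s. cis (2 * pi * real s * real (blk i c) / r) * cnj (cis (2 * pi * real s * real (blk i' c') / r))"
  have "(\<Sum>j\<in>{..<r} \<times> {..<l}. twist (phase j) (shift j) X (P i c a) (P i' c' b))
      = (\<Sum>s<r. \<Sum>t<l. ?z s * ?X t)"
    unfolding sum.cartesian_product
    by (intro sum.cong refl) (auto simp: twist_def phase_P[OF x] phase_P[OF y] shift_P[OF x] shift_P[OF y])
  also have "\<dots> = (\<Sum>s<r. ?z s) * (\<Sum>t<l. ?X t)"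
    by (rule sum_product[symmetric])
  also have "(\<Sum>s<r. ?z s) = (if blk i c = blk i' c' then of_nat r else 0)"
    by (rule sum_roots_of_unity[OF blk_less[OF x(1,2)] blk_less[OF y(1,2)]])
  also have "blk i c = blk i' c' \<longleftrightarrow> i = i' \<and> c = c'"
    using blk_inj[OF x(1,2) y(1,2)] by blast
  finally have sum: "(\<Sum>j\<in>{..<r} \<times> {..<l}. twist (phase j) (shift j) X (P i c a) (P i' c' b))
      = (if i = i' \<and> c = c' then of_nat r else 0) * (\<Sum>t<l. ?X t)" .
  have shift_sum: "(\<Sum>t<l. X $$ (P i ((c + t) mod m i) a, P i ((c + t) mod m i) b))
      = (\<Sum>t<l. X $$ (P i (t mod m i) a, P i (t mod m i) b))"
    using sum_mod_shift[OF dvd_l[OF x(1)], of "\<lambda>t. X $$ (P i t a, P i t b)"] .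
  show "monomial_avg n ({..<r} \<times> {..<l}) phase shift X $$ (P i c a, P i' c' b)
    = (if i = i' \<and> c = c' then (\<Sum>t<l. X $$ (P i (t mod m i) a, P i (t mod m i) b)) / of_nat l else 0)"
    unfolding monomial_avg_index[OF P_less[OF x] P_less[OF y]] sum
    using r_pos l_pos shift_sum by (auto simp: card_cartesian_product)
qed simp

sublocale monomial_averaging n "{..<r} \<times> {..<l}" phase shift "{A. \<exists>\<alpha>. has_blocks A \<alpha>}" "(0, 0)"
proof
  show "finite ({..<r} \<times> {..<l})" by simp
  show "(0, 0) \<in> {..<r} \<times> {..<l}" using r_pos l_pos by simp
  show "phase (0, 0) x = 1" if "x < n" for x
    using that by (cases rule: P_cases) (simp add: phase_P)
  show "shift (0, 0) x = x" if "x < n" for x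
    using that by (cases rule: P_cases) (simp add: shift_P)
  show "bij_betw (shift j) {..<n} {..<n}" for j by (rule bij_shift)
  show "cmod (phase j x) = 1" for j x by (simp add: phase_def split: prod.split)
  show "{A. \<exists>\<alpha>. has_blocks A \<alpha>} \<subseteq> carrier_mat n n" using has_blocks_carrier by blast
  show "monomial_avg n ({..<r} \<times> {..<l}) phase shift X \<in> {A. \<exists>\<alpha>. has_blocks A \<alpha>}"
    if "X \<in> carrier_mat n n" for X
    using has_blocks_avg[OF that] by blast
  show "D = 0\<^sub>m n n" if "D \<in> {A. \<exists>\<alpha>. has_blocks A \<alpha>}"
    "\<And>e. e \<in> {A. \<exists>\<alpha>. has_blocks A \<alpha>} \<Longrightarrow> mat_adjoint e = e \<Longrightarrow> e * e = e \<Longrightarrow> tau (e * D) = 0" for D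
    using that has_blocks_zeroI by blast
  show "twist (phase j) (shift j) A x y = A $$ (x, y)"
    if "A \<in> {A. \<exists>\<alpha>. has_blocks A \<alpha>}" "x < n" "y < n" for A j x y
  proof -
    from \<open>A \<in> _\<close> obtain \<alpha> where A: "has_blocks A \<alpha>" by blast
    obtain i c a where x: "x = P i c a" "i < L" "c < m i" "a < d i" using P_cases[OF \<open>x < n\<close>] .
    obtain i' c' b where y: "y = P i' c' b" "i' < L" "c' < m i'" "b < d i'" using P_cases[OF \<open>y < n\<close>] .
    obtain s t where j: "j = (s, t)" by (cases j)
    have ms: "(c + t) mod m i < m i" "(c' + t) mod m i' < m i'" using x y by simp_all
    \<comment> \<open>Both positions rotate by the same \<open>t\<close>, so two copies coincide
      after the shift exactly if they did before.\<close>
    have "i = i' \<and> (c + t) mod m i = (c' + t) mod m i' \<longleftrightarrow> i = i' \<and> c = c'"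
      using x y by (auto simp: mod_add_right_cancel_less)
    then have "A $$ (P i ((c + t) mod m i) a, P i' ((c' + t) mod m i') b) = A $$ (x, y)"
      unfolding x(1) y(1) has_blocksD[OF A x(2) ms(1) x(4) y(2) ms(2) y(4)] has_blocksD[OF A x(2-4) y(2-4)]
      by simp
    \<comment> \<open>The phase is constant on each diagonal block, and off these blocks
      \<open>A\<close> is zero.\<close>
    moreover have "A $$ (x, y) = 0 \<or> phase j x * cnj (phase j y) = 1"
      unfolding x(1) y(1) has_blocksD[OF A x(2-4) y(2-4)] j phase_P[OF x(2-4)] phase_P[OF y(2-4)]
      by (simp add: cis_cnj cis_mult)
    ultimately show ?thesis
      by (auto simp: twist_def j x(1) y(1) shift_P[OF x(2-4)] shift_P[OF y(2-4)])
  qed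
qed

end

section \<open>Refined partitions\<close>

text \<open>Flat index of place \<open>a\<close> in segment \<open>k\<close>, for consecutive
  segments of lengths \<open>ds\<close>. It serves at two levels: copies within the summands
  (\<open>block_index\<close>) and rows within the diagonal blocks
  (\<open>position\<close>).\<close>

definition offset :: "nat list \<Rightarrow> nat \<Rightarrow> nat \<Rightarrow> nat" where
  "offset ds k a = sum_list (take k ds) + a"

lemma offset_simps [simp]:
  "offset ds 0 a = a"
  "offset (x # ds) (Suc k) a = x + offset ds k a"
  by (simp_all add: offset_def)

lemma offset_less: "k < length ds \<Longrightarrow> a < ds ! k \<Longrightarrow> offset ds k a < sum_list ds"
proof (induction ds arbitrary: k)
  case (Cons x ds)
  then show ?case by (cases k) (simp_all add: trans_less_add1)
qed simp

lemma offset_inj: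
  "k < length ds \<Longrightarrow> a < ds ! k \<Longrightarrow> k' < length ds \<Longrightarrow> b < ds ! k' \<Longrightarrow>
    offset ds k a = offset ds k' b \<longleftrightarrow> k = k' \<and> a = b"
proof (induction ds arbitrary: k k')
  case (Cons x ds)
  then show ?case by (cases k; cases k') auto
qed simp

lemma offset_surj: "x < sum_list ds \<Longrightarrow> \<exists>k<length ds. \<exists>a<ds ! k. x = offset ds k a"
proof (induction ds arbitrary: x)
  case (Cons y ds)
  show ?case
  proof (cases "x < y")
    case True
    then have "x < (y # ds) ! 0 \<and> x = offset (y # ds) 0 x" by simp
    then show ?thesis by (metis length_greater_0_conv list.distinct(1))
  next
    case False
    then have "x - y < sum_list ds" using Cons.prems by simp
    then obtain k a where "k < length ds" "a < ds ! k" "x - y = offset ds k a"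
      using Cons.IH by blast
    then have "Suc k < length (y # ds)" "a < (y # ds) ! Suc k" "x = offset (y # ds) (Suc k) a"
      using False by simp_all
    then show ?thesis by blast
  qed
qed simp

lemma concat_nth_offset:
  "i < length xss \<Longrightarrow> c < length (xss ! i) \<Longrightarrow> concat xss ! offset (map length xss) i c = xss ! i ! c"
proof (induction xss arbitrary: i)
  case (Cons xs xss)
  then show ?case by (cases i) (simp_all add: nth_append)
qed simp

text \<open>Closed form of a recursive construction, by peeling off the first block. Square blocks
  let the same offsets address rows and columns.\<close>

lemma diag_block_mat_offset:
  assumes "\<forall>A\<in>set Bs. square_mat A"
    and "k < length Bs" "a < dim_row (Bs ! k)" "k' < length Bs" "b < dim_row (Bs ! k')"
  shows "diag_block_mat Bs $$ (offset (map dim_row Bs) k a, offset (map dim_row Bs) k' b)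
    = (if k = k' then Bs ! k $$ (a, b) else 0)"
  using assms
proof (induction Bs arbitrary: k k')
  case (Cons A Bs)
  let ?ds = "map dim_row Bs"
  have A: "dim_col A = dim_row A" using Cons.prems(1) by simp
  have "square_mat (diag_block_mat Bs)" using Cons.prems(1) by (intro diag_block_mat_square) simp
  then have D: "dim_row (diag_block_mat Bs) = sum_list ?ds" "dim_col (diag_block_mat Bs) = sum_list ?ds"
    by (simp_all add: dim_diag_block_mat)
  have less: "offset ?ds j e < sum_list ?ds" if "j < length Bs" "e < dim_row (Bs ! j)" for j e
    using offset_less[of j ?ds e] that by simp
  show ?case
  proof (cases k; cases k')
    fix j j' assume "k = Suc j" "k' = Suc j'"
    then show ?thesis
      using Cons.prems Cons.IH[of j j'] less[of j a] less[of j' b] A D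
      by (simp add: Let_def)
  qed (use Cons.prems less A D in \<open>auto simp add: Let_def\<close>)
qed simp

section \<open>Matrix positions and the subalgebra of a refined partition\<close>

definition block_dims :: "(nat \<times> nat) list \<Rightarrow> nat list" where
  "block_dims lam = concat (map (\<lambda>(k, m). replicate m k) lam)"

definition block_index :: "(nat \<times> nat) list \<Rightarrow> nat \<Rightarrow> nat \<Rightarrow> nat" where
  "block_index lam = offset (map snd lam)"

definition position :: "(nat \<times> nat) list \<Rightarrow> nat \<Rightarrow> nat \<Rightarrow> nat \<Rightarrow> nat" where
  "position lam i c a = offset (block_dims lam) (block_index lam i c) a"

lemma length_block_dims: "length (block_dims lam) = sum_list (map snd lam)"
  by (induction lam) (auto simp: block_dims_def)

lemma sum_list_block_dims: "sum_list (block_dims lam) = (\<Sum>(k, m)\<leftarrow>lam. m * k)"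
  by (induction lam) (auto simp: block_dims_def sum_list_replicate)

lemma block_index_less:
  "i < length lam \<Longrightarrow> c < snd (lam ! i) \<Longrightarrow> block_index lam i c < sum_list (map snd lam)"
  unfolding block_index_def by (rule offset_less) simp_all

lemma block_index_inj:
  "i < length lam \<Longrightarrow> c < snd (lam ! i) \<Longrightarrow> i' < length lam \<Longrightarrow> c' < snd (lam ! i') \<Longrightarrow>
    block_index lam i c = block_index lam i' c' \<longleftrightarrow> i = i' \<and> c = c'"
  unfolding block_index_def by (rule offset_inj) simp_all

lemma block_dims_nth:
  assumes "i < length lam" "c < snd (lam ! i)"
  shows "block_dims lam ! block_index lam i c = fst (lam ! i)"
proof -
  define xss where "xss = map (\<lambda>(k, m). replicate m k) lam"
  have "map length xss = map snd lam" by (simp add: xss_def case_prod_unfold)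
  moreover have "i < length xss" "xss ! i = replicate (snd (lam ! i)) (fst (lam ! i))"
    using assms by (simp_all add: xss_def case_prod_unfold)
  ultimately show ?thesis
    using concat_nth_offset[of i xss c] assms
    by (simp add: block_dims_def block_index_def flip: xss_def)
qed

text \<open>Two nested decompositions: a row determines its diagonal block and its place there, and
  the block determines its summand and copy. Injectivity and surjectivity of \<open>offset\<close>
  are used once at each level.\<close>

lemma bij_betw_position:
  assumes "n = (\<Sum>(k, m)\<leftarrow>lam. m * k)"
  shows "bij_betw (\<lambda>(i, c, a). position lam i c a)
    (SIGMA i:{..<length lam}. {..<snd (lam ! i)} \<times> {..<fst (lam ! i)}) {..<n}"
    (is "bij_betw ?P ?S _")
proof (rule bij_betw_imageI)
  note len = length_block_dims[of lam] and nth = block_dims_nth and less = block_index_less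
  show "inj_on ?P ?S"
  proof (rule inj_onI)
    fix z z' assume "z \<in> ?S" "z' \<in> ?S" and eq: "?P z = ?P z'"
    then obtain i c a i' c' b
      where z: "z = (i, c, a)" "i < length lam" "c < snd (lam ! i)" "a < fst (lam ! i)"
        and z': "z' = (i', c', b)" "i' < length lam" "c' < snd (lam ! i')" "b < fst (lam ! i')"
      by auto
    then have "block_index lam i c = block_index lam i' c' \<and> a = b"
      using eq by (simp add: position_def offset_inj len nth less)
    then show "z = z'" using z z' by (simp add: block_index_inj)
  qed
  show "?P ` ?S = {..<n}"
  proof (intro equalityI subsetI)
    fix x assume "x \<in> ?P ` ?S"
    then obtain i c a where x: "i < length lam" "c < snd (lam ! i)" "a < fst (lam ! i)"
      "x = position lam i c a" by auto
    then show "x \<in> {..<n}"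
      using offset_less[of "block_index lam i c" "block_dims lam" a]
      by (simp add: assms position_def len nth less sum_list_block_dims)
  next
    fix x assume "x \<in> {..<n}"
    then obtain k a where k: "k < length (block_dims lam)" "a < block_dims lam ! k"
      "x = offset (block_dims lam) k a"
      using offset_surj[of x "block_dims lam"] by (auto simp: assms sum_list_block_dims)
    then obtain i c where "i < length lam" "c < snd (lam ! i)" "k = block_index lam i c"
      using offset_surj[of k "map snd lam"] by (auto simp: len block_index_def)
    then have "(i, c, a) \<in> ?S" "x = ?P (i, c, a)"
      using k by (simp_all add: nth position_def)
    then show "x \<in> ?P ` ?S" by blast
  qed
qed

lemma block_labelling_position:
  assumes "refined_partition n lam"
  shows "block_labelling n (sum_list (map snd lam)) (Lcm (set (map snd lam))) (length lam)
    (\<lambda>i. snd (lam ! i)) (\<lambda>i. fst (lam ! i)) (position lam) (block_index lam)"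
proof
  have lam: "lam \<noteq> []" "n = (\<Sum>(k, m)\<leftarrow>lam. m * k)" "\<forall>m\<in>set (map snd lam). 1 \<le> m"
    using assms by (auto simp: refined_partition_def)
  show "bij_betw (\<lambda>(i, c, a). position lam i c a)
    (SIGMA i:{..<length lam}. {..<snd (lam ! i)} \<times> {..<fst (lam ! i)}) {..<n}"
    by (rule bij_betw_position[OF lam(2)])
  show "0 < sum_list (map snd lam)"
  proof (cases lam)
    case (Cons x xs)
    then show ?thesis using lam(3) by simp
  qed (use lam in simp)
  \<comment> \<open>An \<open>Lcm\<close> of a finite set is zero exactly if 0 is a member; positive
    multiplicities exclude this.\<close>
  have "0 \<notin> set (map snd lam)" using lam(3) by auto
  then have "Lcm (set (map snd lam)) \<noteq> 0" by (simp only: Lcm_0_iff[OF finite_set] not_False_eq_True)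
  then show "0 < Lcm (set (map snd lam))" by (simp only: neq0_conv)
  show "snd (lam ! i) dvd Lcm (set (map snd lam))" if "i < length lam" for i
    by (rule dvd_Lcm) (use that in simp)
qed (simp_all add: block_index_less block_index_inj)

text \<open>Translates lists of matrices into coefficient functions, so that the averaging results
  apply to \<open>subalg\<close>: the coefficients are the entries of the \<open>A_i\<close>, and
  conversely the \<open>A_i\<close> are tabulated from the coefficients.\<close>

lemma subalg_eq:
  assumes "refined_partition n lam"
  shows "subalg lam = {A. \<exists>\<alpha>. block_labelling.has_blocks n (length lam)
    (\<lambda>i. snd (lam ! i)) (\<lambda>i. fst (lam ! i)) (position lam) A \<alpha>}"
proof -
  interpret block_labelling n "sum_list (map snd lam)" "Lcm (set (map snd lam))" "length lam"
    "\<lambda>i. snd (lam ! i)" "\<lambda>i. fst (lam ! i)" "position lam" "block_index lam"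
    by (rule block_labelling_position[OF assms])
  have n: "n = (\<Sum>(k, m)\<leftarrow>lam. m * k)" using assms by (simp add: refined_partition_def)
  let ?D = "\<lambda>As. diag_block_mat (concat (map2 (\<lambda>(k, m) A. replicate m A) lam As))"
  have blocks: "has_blocks (?D As) (\<lambda>i a b. As ! i $$ (a, b))"
    if len: "length As = length lam"
      and sq: "\<forall>i<length lam. As ! i \<in> carrier_mat (fst (lam ! i)) (fst (lam ! i))" for As
  proof -
    define xss where "xss = map2 (\<lambda>(k, m) A. replicate m A) lam As"
    define Bs where "Bs = concat xss"
    have nth: "xss ! i = replicate (snd (lam ! i)) (As ! i)" if "i < length lam" for i
      using that len by (simp add: xss_def case_prod_unfold)
    have len': "length xss = length lam" using len by (simp add: xss_def)
    have ms: "map length xss = map snd lam"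
      by (rule nth_equalityI) (simp_all add: len' nth)
    have "map (map dim_row) xss = map (\<lambda>(k, m). replicate m k) lam"
      by (rule nth_equalityI) (use sq in \<open>auto simp: len' nth case_prod_unfold\<close>)
    then have dims: "map dim_row Bs = block_dims lam"
      by (simp add: Bs_def block_dims_def map_concat)
    have square: "\<forall>A\<in>set Bs. square_mat A"
    proof
      fix A assume "A \<in> set Bs"
      then obtain i where "i < length xss" "A \<in> set (xss ! i)"
        unfolding Bs_def by (metis UN_E in_set_conv_nth set_concat)
      then have "i < length lam" "A = As ! i" using nth[of i] by (auto simp: len')
      then show "square_mat A" using sq by auto
    qed
    have lenB: "length Bs = sum_list (map snd lam)"
      using ms by (simp add: Bs_def length_concat)
    have Bnth: "Bs ! block_index lam i c = As ! i" if "i < length lam" "c < snd (lam ! i)" for i c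
      using concat_nth_offset[of i xss c] that by (simp add: Bs_def block_index_def ms len' nth)
    have "has_blocks (diag_block_mat Bs) (\<lambda>i a b. As ! i $$ (a, b))"
    proof (rule has_blocksI)
      have "dim_row (diag_block_mat Bs) = n"
        by (simp add: dim_diag_block_mat dims sum_list_block_dims n)
      moreover have "square_mat (diag_block_mat Bs)" by (rule diag_block_mat_square[OF square])
      ultimately show "diag_block_mat Bs \<in> carrier_mat n n" by (intro carrier_matI) simp_all
      fix i c a i' c' b
      assume x: "i < length lam" "c < snd (lam ! i)" "a < fst (lam ! i)"
        and y: "i' < length lam" "c' < snd (lam ! i')" "b < fst (lam ! i')"
      have r: "dim_row (As ! i) = fst (lam ! i)" "dim_row (As ! i') = fst (lam ! i')"
        using sq x y by (blast dest: carrier_matD)+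
      have "diag_block_mat Bs $$ (position lam i c a, position lam i' c' b)
          = (if block_index lam i c = block_index lam i' c' then Bs ! block_index lam i c $$ (a, b) else 0)"
        unfolding position_def dims[symmetric]
        by (rule diag_block_mat_offset[OF square])
          (use x y in \<open>simp_all add: lenB Bnth r block_index_less\<close>)
      also have "\<dots> = (if i = i' \<and> c = c' then As ! i $$ (a, b) else 0)"
        using x y by (simp add: Bnth block_index_inj)
      finally show "diag_block_mat Bs $$ (position lam i c a, position lam i' c' b)
          = (if i = i' \<and> c = c' then As ! i $$ (a, b) else 0)" .
    qed
    then show ?thesis by (simp only: Bs_def xss_def)
  qed
  show ?thesis
  proof (intro equalityI subsetI)
    fix A assume "A \<in> subalg lam"
    then show "A \<in> {A. \<exists>\<alpha>. has_blocks A \<alpha>}"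
      unfolding subalg_def using blocks by blast
  next
    fix A assume "A \<in> {A. \<exists>\<alpha>. has_blocks A \<alpha>}"
    then obtain \<alpha> where A: "has_blocks A \<alpha>" by blast
    define As where "As = map (\<lambda>i. mat (fst (lam ! i)) (fst (lam ! i)) (\<lambda>(a, b). \<alpha> i a b)) [0..<length lam]"
    have As: "length As = length lam"
      "\<forall>i<length lam. As ! i \<in> carrier_mat (fst (lam ! i)) (fst (lam ! i))"
      by (simp_all add: As_def)
    have "A = ?D As"
      by (rule has_blocks_eqI[OF A blocks[OF As]]) (simp add: As_def)
    then show "A \<in> subalg lam"
      unfolding subalg_def using As by blast
  qed
qed

theorem theorem4p6:
  fixes n r l :: nat and lam :: "(nat \<times> nat) list"
  assumes "refined_partition n lam"
    and "r = sum_list (map snd lam)"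
    and "l = Lcm (set (map snd lam))"
  shows "(\<forall>X \<in> carrier_mat n n. psd X \<longrightarrow>
            op_norm (cond_exp n (subalg lam) X) \<ge> 1 / (real r * real l) * op_norm X) \<and>
         (\<forall>X \<in> carrier_mat n n.
            fr_norm n (subalg lam) X \<ge> 1 / sqrt (real r * real l) * op_norm X)"
proof -
  interpret block_labelling n r l "length lam"
    "\<lambda>i. snd (lam ! i)" "\<lambda>i. fst (lam ! i)" "position lam" "block_index lam"
    unfolding assms(2,3) by (rule block_labelling_position[OF assms(1)])
  have rl: "0 < real r * real l" using r_pos l_pos by simp
  have card: "real (card ({..<r} \<times> {..<l})) = real r * real l"
    by (simp add: card_cartesian_product)
  show ?thesis
    unfolding subalg_eq[OF assms(1)]
  proof (intro conjI ballI impI)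
    fix X :: "complex mat" assume X: "X \<in> carrier_mat n n"
    show "1 / (real r * real l) * op_norm X \<le> op_norm (cond_exp n {A. \<exists>\<alpha>. has_blocks A \<alpha>} X)"
      if "psd X"
      using op_norm_le_cond_exp[OF X that] rl unfolding card by (simp add: divide_le_eq mult.commute)
    show "1 / sqrt (real r * real l) * op_norm X \<le> fr_norm n {A. \<exists>\<alpha>. has_blocks A \<alpha>} X"
      using op_norm_le_fr_norm[OF X] rl unfolding card
      by (simp add: divide_le_eq mult.commute del: real_sqrt_mult)
  qed
qed

end
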